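(* Let $G$ be a connected non-bipartite graph and $\Gamma=(G,\sigma)$ a signed graph on $G$. Then $\Gamma\in\mathbb{FS}_1(G)$ if and only if $\Gamma$ is switching isomorphic to a signed graph $\tilde\Gamma$ of the following form. For some integers $s\ge1$ and $0\le m\le s$, the vertex set of $\tilde\Gamma$ is a disjoint union of blocks $\Omega_1,\Omega_2,U_{11},U_{21},U_{12},U_{22},\ldots,U_{1s},U_{2s}$ with $\Omega_1\cup\Omega_2\ne\emptyset$ and $|U_{1j}|=|U_{2j}|$, and the blocks of the symmetric matrix $A(\tilde\Gamma)$ (in suitable orderings of the blocks) are: - $\Omega_1\times\Omega_1$ and $\Omega_2\times\Omega_2$: $0$; $\Omega_1\times\Omega_2$: $A$; - for $1\le j\le m$: $\Omega_1\times U_{1j}$: $D_{1j}$; $\Omega_1\times U_{2j}$: $D_{1j}$; $\Omega_2\times U_{1j}$: $D_{2j}$; $\Omega_2\times U_{2j}$: $-D_{2j}$; - for $m+1\le j\le s$: $\Omega_1\times U_{1j}$: $D_{1j}$; $\Omega_1\times U_{2j}$: $-D_{1j}$; $\Omega_2\times U_{1j}$: $D_{2j}$; $\Omega_2\times U_{2j}$: $D_{2j}$; - for $1\le j\le s$: $(U_{1j}\cup U_{2j})\times(U_{1j}\cup U_{2j})$: $\begin{pmatrix}B_j&Y_j\\-Y_j&-B_j\end{pmatrix}$; - for $j\ne k$: $(U_{1j}\cup U_{2j})\times(U_{1k}\cup U_{2k})$: $0$; where $A$, $D_{1j}$, $D_{2j}$, $B_j$, $Y_j$ are matrices with entries in $\{0,1,-1\}$,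 $B_j$ is symmetric with zero diagonal, and $Y_j^\top=-Y_j$ for $j=1,\ldots,s$.
   Context: Graphs are finite and simple. A signed graph $\Gamma=(G,\sigma)$ on $G$ is $G$ with a function $\sigma:E(G)\to\{+1,-1\}$; its adjacency matrix $A(\Gamma)$ has $(u,v)$-entry $\sigma(uv)$ if $uv\in E(G)$ and $0$ otherwise. Switching $\Gamma$ with respect to $U\subseteq V(G)$ reverses the signs of all edges between $U$ and $V(G)\setminus U$. $\Gamma\simeq\Gamma'$ (switching isomorphic) means $\Gamma$ is isomorphic, by a sign-preserving graph isomorphism, to a switching of $\Gamma'$. $\Gamma$ is sign-symmetric if $\Gamma\simeq-\Gamma=(G,-\sigma)$. The sign of a cycle is the product of the signs of its edges. A weak automorphism of $\Gamma$ is a $\varphi\in Aut(G)$ with $\sigma(\varphi(C))=-\sigma(C)$ for every odd cycle $C$ of $G$ and $\sigma(\varphi(C))=\sigma(C)$ for every even cycle $C$. It is principal if it has the smallest order among all weak automorphisms of $\Gamma$. $\mathbb{S}_1(G)$ is the set of sign-symmetric signed graphs on $G$ having a principal weak automorphism of order $2$; for such $\varphi$, $F=\{v\in V(G)\mid\varphi(v)=v\}$. $\mathbb{FS}_1(G)$ is the set of $\Gamma\in\mathbb{S}_1(G)$ with $F\neq\emptyset$, i.e. having a principal weak automorphism of order $2$ with at least one fixed vertex. One of $\Omega_1,\Omega_2$ may be empty. *)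

theory Defs
  imports "HOL-Combinatorics.Permutations" "Jordan_Normal_Form.Matrix"
begin

record 'a graph =
  verts :: "'a set"
  edges :: "'a set set"

text \<open>A signed graph is a pair of a graph and a sign function on its edges. The values of the sign
  function on sets that are not edges carry no information, and no notion below depends on
  them.\<close>

type_synonym 'a signed_graph = "'a graph \<times> ('a set \<Rightarrow> int)"

definition simple_graph :: "'a graph \<Rightarrow> bool" where
  "simple_graph G \<longleftrightarrow>
     finite (verts G) \<and> (\<forall>e\<in>edges G. \<exists>u\<in>verts G. \<exists>v\<in>verts G. u \<noteq> v \<and> e = {u, v})"

fun signed_graph :: "'a signed_graph \<Rightarrow> bool" where
  "signed_graph (G, \<sigma>) \<longleftrightarrow> simple_graph G \<and> (\<forall>e\<in>edges G. \<sigma> e \<in> {1, -1})"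

definition connected_graph :: "'a graph \<Rightarrow> bool" where
  "connected_graph G \<longleftrightarrow>
     verts G \<noteq> {} \<and> (\<forall>u\<in>verts G. \<forall>v\<in>verts G. (u, v) \<in> {(x, y). {x, y} \<in> edges G}\<^sup>*)"

definition bipartite :: "'a graph \<Rightarrow> bool" where
  "bipartite G \<longleftrightarrow>
     (\<exists>X Y. X \<union> Y = verts G \<and> X \<inter> Y = {} \<and> (\<forall>e\<in>edges G. \<exists>x\<in>X. \<exists>y\<in>Y. e = {x, y}))"

fun adjacency :: "'a signed_graph \<Rightarrow> 'a \<Rightarrow> 'a \<Rightarrow> int" where
  "adjacency (G, \<sigma>) u v = (if {u, v} \<in> edges G then \<sigma> {u, v} else 0)"


subsection \<open>Switching isomorphism and sign-symmetry\<close>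

fun switching :: "'a set \<Rightarrow> 'a signed_graph \<Rightarrow> 'a signed_graph" where
  "switching U (G, \<sigma>) =
     (G, \<lambda>e. if \<exists>u\<in>U. \<exists>v\<in>verts G - U. e = {u, v} then - \<sigma> e else \<sigma> e)"

fun signed_iso :: "('a \<Rightarrow> 'b) \<Rightarrow> 'a signed_graph \<Rightarrow> 'b signed_graph \<Rightarrow> bool" where
  "signed_iso f (G, \<sigma>) (H, \<tau>) \<longleftrightarrow>
     bij_betw f (verts G) (verts H) \<and>
     (\<forall>u\<in>verts G. \<forall>v\<in>verts G. {u, v} \<in> edges G \<longleftrightarrow> {f u, f v} \<in> edges H) \<and>
     (\<forall>e\<in>edges G. \<tau> (f ` e) = \<sigma> e)"

definition switching_isomorphic :: "'a signed_graph \<Rightarrow> 'b signed_graph \<Rightarrow> bool"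
    (infix \<open>\<simeq>\<^sub>s\<close> 50) where
  "\<Gamma> \<simeq>\<^sub>s \<Gamma>' \<longleftrightarrow> (\<exists>U f. U \<subseteq> verts (fst \<Gamma>') \<and> signed_iso f \<Gamma> (switching U \<Gamma>'))"

fun neg_signed :: "'a signed_graph \<Rightarrow> 'a signed_graph" where
  "neg_signed (G, \<sigma>) = (G, \<lambda>e. - \<sigma> e)"

definition sign_symmetric :: "'a signed_graph \<Rightarrow> bool" where
  "sign_symmetric \<Gamma> \<longleftrightarrow> \<Gamma> \<simeq>\<^sub>s neg_signed \<Gamma>"


subsection \<open>Weak automorphisms\<close>

text \<open>A cycle is given by the list of its vertices in cyclic order. For at least three distinct
  vertices the listed edges are pairwise distinct, so a cycle of length \<open>n\<close> has \<open>n\<close> edges and its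
  sign is a product over the set of its edges.\<close>

definition cycle_edges :: "'a list \<Rightarrow> 'a set set" where
  "cycle_edges c = {{c ! i, c ! (Suc i mod length c)} | i. i < length c}"

definition graph_cycle :: "'a graph \<Rightarrow> 'a list \<Rightarrow> bool" where
  "graph_cycle G c \<longleftrightarrow> 3 \<le> length c \<and> distinct c \<and> cycle_edges c \<subseteq> edges G"

definition cycle_sign :: "('a set \<Rightarrow> int) \<Rightarrow> 'a list \<Rightarrow> int" where
  "cycle_sign \<sigma> c = (\<Prod>e\<in>cycle_edges c. \<sigma> e)"

text \<open>Automorphisms are extended to the whole type by the identity outside the vertex set, so
  equality of functions is equality of automorphisms.\<close>

definition Aut :: "'a graph \<Rightarrow> ('a \<Rightarrow> 'a) set" where
  "Aut G = {\<phi>. \<phi> permutes verts G \<and>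
     (\<forall>u\<in>verts G. \<forall>v\<in>verts G. {u, v} \<in> edges G \<longleftrightarrow> {\<phi> u, \<phi> v} \<in> edges G)}"

definition perm_order :: "('a \<Rightarrow> 'a) \<Rightarrow> nat" where
  "perm_order \<phi> = (LEAST n. 0 < n \<and> \<phi> ^^ n = id)"

fun weak_automorphism :: "'a signed_graph \<Rightarrow> ('a \<Rightarrow> 'a) \<Rightarrow> bool" where
  "weak_automorphism (G, \<sigma>) \<phi> \<longleftrightarrow>
     \<phi> \<in> Aut G \<and>
     (\<forall>c. graph_cycle G c \<and> odd (length c) \<longrightarrow> cycle_sign \<sigma> (map \<phi> c) = - cycle_sign \<sigma> c) \<and>
     (\<forall>c. graph_cycle G c \<and> even (length c) \<longrightarrow> cycle_sign \<sigma> (map \<phi> c) = cycle_sign \<sigma> c)"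

definition principal_weak_automorphism :: "'a signed_graph \<Rightarrow> ('a \<Rightarrow> 'a) \<Rightarrow> bool" where
  "principal_weak_automorphism \<Gamma> \<phi> \<longleftrightarrow>
     weak_automorphism \<Gamma> \<phi> \<and> (\<forall>\<psi>. weak_automorphism \<Gamma> \<psi> \<longrightarrow> perm_order \<phi> \<le> perm_order \<psi>)"

definition S1 :: "'a graph \<Rightarrow> 'a signed_graph set" where
  "S1 G = {\<Gamma>. signed_graph \<Gamma> \<and> fst \<Gamma> = G \<and> sign_symmetric \<Gamma> \<and>
     (\<exists>\<phi>. principal_weak_automorphism \<Gamma> \<phi> \<and> perm_order \<phi> = 2)}"

definition FS1 :: "'a graph \<Rightarrow> 'a signed_graph set" where
  "FS1 G = {\<Gamma> \<in> S1 G. \<exists>\<phi>. principal_weak_automorphism \<Gamma> \<phi> \<and> perm_order \<phi> = 2 \<and>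
     {v \<in> verts G. \<phi> v = v} \<noteq> {}}"


subsection \<open>The block form\<close>

definition adj_block :: "'a signed_graph \<Rightarrow> 'a list \<Rightarrow> 'a list \<Rightarrow> int mat" where
  "adj_block \<Gamma> us vs =
     mat (length us) (length vs) (\<lambda>(i, j). adjacency \<Gamma> (us ! i) (vs ! j))"

text \<open>Blocks of vertices are lists, which also record the ordering of the block. The blocks
  \<open>U1 j\<close> and \<open>U2 j\<close> are nonempty, whereas one of \<open>\<Omega>1\<close> and \<open>\<Omega>2\<close> may be empty. The blocks of the
  adjacency matrix that are not listed are determined by its symmetry.\<close>

definition block_form :: "'a signed_graph \<Rightarrow> bool" where
  "block_form \<Gamma> \<longleftrightarrow>
     (\<exists>(s::nat) (m::nat) (\<Omega>1 :: 'a list) (\<Omega>2 :: 'a list)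
        (U1 :: nat \<Rightarrow> 'a list) (U2 :: nat \<Rightarrow> 'a list)
        (A :: int mat) (D1 :: nat \<Rightarrow> int mat) (D2 :: nat \<Rightarrow> int mat)
        (B :: nat \<Rightarrow> int mat) (Y :: nat \<Rightarrow> int mat).
        1 \<le> s \<and> m \<le> s \<and>
        (let vs = \<Omega>1 @ \<Omega>2 @ concat (map (\<lambda>j. U1 j @ U2 j) [1..<Suc s])
         in distinct vs \<and> set vs = verts (fst \<Gamma>)) \<and>
        set \<Omega>1 \<union> set \<Omega>2 \<noteq> {} \<and>
        (\<forall>j\<in>{1..s}. U1 j \<noteq> [] \<and> length (U1 j) = length (U2 j)) \<and>
        adj_block \<Gamma> \<Omega>1 \<Omega>1 = 0\<^sub>m (length \<Omega>1) (length \<Omega>1) \<and>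
        adj_block \<Gamma> \<Omega>2 \<Omega>2 = 0\<^sub>m (length \<Omega>2) (length \<Omega>2) \<and>
        adj_block \<Gamma> \<Omega>1 \<Omega>2 = A \<and>
        (\<forall>j\<in>{1..m}.
           adj_block \<Gamma> \<Omega>1 (U1 j) = D1 j \<and> adj_block \<Gamma> \<Omega>1 (U2 j) = D1 j \<and>
           adj_block \<Gamma> \<Omega>2 (U1 j) = D2 j \<and> adj_block \<Gamma> \<Omega>2 (U2 j) = - D2 j) \<and>
        (\<forall>j\<in>{m+1..s}.
           adj_block \<Gamma> \<Omega>1 (U1 j) = D1 j \<and> adj_block \<Gamma> \<Omega>1 (U2 j) = - D1 j \<and>
           adj_block \<Gamma> \<Omega>2 (U1 j) = D2 j \<and> adj_block \<Gamma> \<Omega>2 (U2 j) = D2 j) \<and>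
        (\<forall>j\<in>{1..s}.
           adj_block \<Gamma> (U1 j @ U2 j) (U1 j @ U2 j) =
             four_block_mat (B j) (Y j) (- Y j) (- B j)) \<and>
        (\<forall>j\<in>{1..s}. \<forall>k\<in>{1..s}. j \<noteq> k \<longrightarrow>
           adj_block \<Gamma> (U1 j @ U2 j) (U1 k @ U2 k) =
             0\<^sub>m (length (U1 j @ U2 j)) (length (U1 k @ U2 k))) \<and>
        elements_mat A \<subseteq> {0, 1, -1} \<and>
        (\<forall>j\<in>{1..s}.
           B j \<in> carrier_mat (length (U1 j)) (length (U1 j)) \<and>
           Y j \<in> carrier_mat (length (U1 j)) (length (U1 j)) \<and>
           elements_mat (D1 j) \<subseteq> {0, 1, -1} \<and> elements_mat (D2 j) \<subseteq> {0, 1, -1} \<and>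
           elements_mat (B j) \<subseteq> {0, 1, -1} \<and> elements_mat (Y j) \<subseteq> {0, 1, -1} \<and>
           (B j)\<^sup>T = B j \<and> (\<forall>i<dim_row (B j). B j $$ (i, i) = 0) \<and>
           (Y j)\<^sup>T = - Y j))"

end

theory Submission
  imports Defs "HOL-Combinatorics.Cycles"
begin

text \<open>Harary's balance theorem turns the condition on cycles into a switching identity: \<open>\<phi>\<close> is a
  weak automorphism iff there is \<open>\<theta>\<close> with values \<open>1\<close> and \<open>-1\<close> such that
  \<open>\<sigma>(\<phi> u, \<phi> v) = - \<theta> u * \<theta> v * \<sigma>(u, v)\<close>. If \<open>\<phi>\<close> is an involution with a fixed vertex, then
  \<open>\<theta>\<close> is \<open>\<phi>\<close>-invariant, and a switching makes it \<open>1\<close> on all vertices that \<open>\<phi>\<close> moves; the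
  identity is then the block form, with \<open>\<Omega>\<^sub>1\<close> and \<open>\<Omega>\<^sub>2\<close> the fixed vertices where \<open>\<theta>\<close> is \<open>1\<close> and
  \<open>-1\<close>. Conversely, exchanging \<open>U\<^sub>1\<^sub>j\<close> and \<open>U\<^sub>2\<^sub>j\<close> in a block form satisfies such an identity. No weak
  automorphism is trivial, because a non-bipartite graph has an odd cycle.\<close>

section \<open>Signs of walks and balance\<close>

lemma pm_one_square: "(x::int) \<in> {1, -1} \<Longrightarrow> x * x = 1"
  by auto

lemma simple_graph_edgeE:
  assumes "simple_graph G" "e \<in> edges G"
  obtains u v where "u \<in> verts G" "v \<in> verts G" "u \<noteq> v" "e = {u, v}"
proof -
  have "\<forall>e\<in>edges G. \<exists>x\<in>verts G. \<exists>y\<in>verts G. x \<noteq> y \<and> e = {x, y}"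
    using assms(1) by (simp add: simple_graph_def)
  from bspec[OF this assms(2)] show ?thesis using that by (elim bexE conjE)
qed

lemma signed_graphD:
  assumes "signed_graph (G, \<sigma>)"
  shows "simple_graph G" "finite (verts G)" "e \<in> edges G \<Longrightarrow> \<sigma> e \<in> {1, -1}"
    "{u, v} \<in> edges G \<Longrightarrow> u \<in> verts G \<and> v \<in> verts G \<and> u \<noteq> v"
proof -
  show "simple_graph G" "finite (verts G)" "e \<in> edges G \<Longrightarrow> \<sigma> e \<in> {1, -1}"
    using assms by (auto simp: simple_graph_def)
  assume e: "{u, v} \<in> edges G"
  have "simple_graph G" using assms by simp
  then obtain x y where "x \<in> verts G" "y \<in> verts G" "x \<noteq> y" "{u, v} = {x, y}"
    using e by (rule simple_graph_edgeE)
  moreover from this have "u = x \<and> v = y \<or> u = y \<and> v = x" by (simp only: doubleton_eq_iff)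
  ultimately show "u \<in> verts G \<and> v \<in> verts G \<and> u \<noteq> v" by blast
qed

section \<open>Walks and the multiplicativity of their signs\<close>

abbreviation walk :: "'a graph \<Rightarrow> 'a list \<Rightarrow> bool" where
  "walk G \<equiv> successively (\<lambda>x y. {x, y} \<in> edges G)"

fun walk_sign :: "('a set \<Rightarrow> int) \<Rightarrow> 'a list \<Rightarrow> int" where
  "walk_sign \<sigma> (x # y # zs) = \<sigma> {x, y} * walk_sign \<sigma> (y # zs)"
| "walk_sign \<sigma> _ = 1"

text \<open>The shared vertex ends the first walk and starts the second, so every edge is counted
  once.\<close>

lemma walk_sign_append:
  "walk_sign \<sigma> (xs @ x # ys) = walk_sign \<sigma> (xs @ [x]) * walk_sign \<sigma> (x # ys)"
proof (induction xs)
  case (Cons a xs)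
  then show ?case by (cases xs) auto
qed simp

lemma walk_sign_rev: "walk_sign \<sigma> (rev w) = walk_sign \<sigma> w"
proof (induction \<sigma> w rule: walk_sign.induct)
  case (1 \<sigma> x y zs)
  then show ?case
    using walk_sign_append[of \<sigma> "rev zs" y "[x]"] by (simp add: insert_commute)
qed auto

lemma walk_rev: "walk G (rev w) \<longleftrightarrow> walk G w"
  by (simp add: insert_commute)

lemma walk_append: "walk G (xs @ x # ys) \<longleftrightarrow> walk G (xs @ [x]) \<and> walk G (x # ys)"
  by (auto simp: successively_append_iff successively_Cons)

section \<open>Cycles as closed walks\<close>

lemma walk_sign_eq_prod:
  "walk_sign \<sigma> w = (\<Prod>i<length w - 1. \<sigma> {w ! i, w ! Suc i})"
proof (induction \<sigma> w rule: walk_sign.induct)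
  case (1 \<sigma> x y zs)
  then show ?case by (simp add: prod.lessThan_Suc_shift del: prod.lessThan_Suc)
qed auto

lemma walk_nth: "walk G w \<longleftrightarrow> (\<forall>i<length w - 1. {w ! i, w ! Suc i} \<in> edges G)"
  by (auto simp: successively_conv_nth)

text \<open>Repeating the head at the end turns the cyclic successor, taken modulo the length, into
  the ordinary successor.\<close>

lemma closed_list_nth:
  assumes "i < length c"
  shows "(c @ [hd c]) ! i = c ! i" "(c @ [hd c]) ! Suc i = c ! (Suc i mod length c)"
proof -
  show "(c @ [hd c]) ! i = c ! i" using assms by (simp add: nth_append)
  show "(c @ [hd c]) ! Suc i = c ! (Suc i mod length c)"
  proof (cases "Suc i = length c")
    case True
    then show ?thesis by (cases c) (auto simp: nth_append)
  next
    case False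
    then show ?thesis using assms by (simp add: nth_append)
  qed
qed

lemma cycle_edges_eq_image:
  "cycle_edges c = (\<lambda>i. {c ! i, c ! (Suc i mod length c)}) ` {..<length c}"
  by (auto simp: cycle_edges_def)

text \<open>The cycle sign is a product over a set of edges, the walk sign over positions. They
  agree because three or more distinct vertices give pairwise distinct edges.\<close>

lemma cycle_sign_eq_walk_sign:
  assumes "distinct c" "3 \<le> length c"
  shows "cycle_sign \<sigma> c = walk_sign \<sigma> (c @ [hd c])"
proof -
  let ?n = "length c"
  have "inj_on (\<lambda>i. {c ! i, c ! (Suc i mod ?n)}) {..<?n}"
  proof (rule inj_onI)
    fix i j assume ij: "i \<in> {..<?n}" "j \<in> {..<?n}"
      and eq: "{c ! i, c ! (Suc i mod ?n)} = {c ! j, c ! (Suc j mod ?n)}"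
    have m: "Suc i mod ?n < ?n" "Suc j mod ?n < ?n" using assms(2) by (auto intro: mod_less_divisor)
    \<comment> \<open>Two different positions with the same edge would be cyclic successors of each
      other, so the length would divide 2.\<close>
    have "i = j \<or> (i = Suc j mod ?n \<and> Suc i mod ?n = j)"
      using eq assms(1) ij m by (auto simp: doubleton_eq_iff nth_eq_iff_index_eq)
    then show "i = j"
      using ij assms(2) by (auto simp: mod_Suc split: if_splits)
  qed
  then have "cycle_sign \<sigma> c = (\<Prod>i<?n. \<sigma> {c ! i, c ! (Suc i mod ?n)})"
    by (simp add: cycle_sign_def cycle_edges_eq_image prod.reindex)
  also have "\<dots> = walk_sign \<sigma> (c @ [hd c])"
    unfolding walk_sign_eq_prod by (rule prod.cong) (auto simp: closed_list_nth)
  finally show ?thesis .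
qed

lemma cycle_edges_subset_iff_walk:
  "cycle_edges c \<subseteq> edges G \<longleftrightarrow> walk G (c @ [hd c])"
  unfolding walk_nth cycle_edges_eq_image by (auto simp: closed_list_nth)

lemma graph_cycle_walk: "graph_cycle G c \<Longrightarrow> walk G (c @ [hd c])"
  by (simp add: graph_cycle_def cycle_edges_subset_iff_walk)

lemma graph_cycle_sign: "graph_cycle G c \<Longrightarrow> cycle_sign \<sigma> c = walk_sign \<sigma> (c @ [hd c])"
  by (simp add: graph_cycle_def cycle_sign_eq_walk_sign)

text \<open>Injectivity keeps the image list distinct, so the product formula applies before the
  image is known to be a cycle of the graph.\<close>

lemma cycle_sign_map:
  assumes "inj \<phi>" "graph_cycle G c"
  shows "cycle_sign \<sigma> (map \<phi> c) = walk_sign \<sigma> (map \<phi> (c @ [hd c]))"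
proof -
  have c: "distinct c" "3 \<le> length c" "c \<noteq> []" using assms(2) by (auto simp: graph_cycle_def)
  have "distinct (map \<phi> c)" using c(1) inj_on_subset[OF assms(1)] by (simp add: distinct_map)
  then show ?thesis using c by (simp add: cycle_sign_eq_walk_sign hd_map)
qed

section \<open>Harary's balance theorem\<close>

lemma walk_sign_pm_one:
  assumes "signed_graph (G, s)" "walk G w"
  shows "walk_sign s w \<in> {1, -1}"
  using assms(2)
proof (induction w rule: induct_list012)
  case (3 x y zs)
  then show ?case using signed_graphD(3)[OF assms(1), of "{x, y}"] by auto
qed auto

text \<open>Strong induction on the length. A repeated vertex splits the closed walk into two
  shorter closed walks whose signs multiply. Without repetition it is a cycle, an edge traversed
  forth and back, or a single vertex.\<close>

lemma closed_walk_sign: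
  assumes G: "signed_graph (G, s)"
    and cyc: "\<And>c. graph_cycle G c \<Longrightarrow> cycle_sign s c = 1"
  shows "walk G w \<Longrightarrow> w \<noteq> [] \<Longrightarrow> hd w = last w \<Longrightarrow> walk_sign s w = 1"
proof (induction "length w" arbitrary: w rule: less_induct)
  case less
  show ?case
  proof (cases "length w = 1")
    case True
    then show ?thesis by (cases w) auto
  next
    case False
    define c where "c = butlast w"
    have w: "w = c @ [hd c]" and c: "c \<noteq> []"
    proof -
      show "c \<noteq> []" using False less.prems by (cases w rule: rev_cases) (auto simp: c_def)
      then have "hd c = hd w" by (cases w) (auto simp: c_def split: if_splits)
      then show "w = c @ [hd c]" using less.prems by (simp add: c_def)
    qed
    show ?thesis
    proof (cases "distinct c")
      case True
      have "length c \<noteq> 0" using c by simp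
      then have "length c = 1 \<or> length c = 2 \<or> 3 \<le> length c" by linarith
      then consider "length c = 1" | "length c = 2" | "3 \<le> length c" by blast
      then show ?thesis
      proof cases
        case 1
        then obtain x where "c = [x]" by (auto simp: length_Suc_conv)
        then show ?thesis using less.prems(1) w signed_graphD(4)[OF G, of x x] by auto
      next
        case 2
        then obtain x y where "c = [x, y]" by (auto simp: length_Suc_conv numeral_2_eq_2)
        then show ?thesis
          using less.prems(1) w pm_one_square[OF signed_graphD(3)[OF G, of "{x, y}"]]
          by (auto simp: insert_commute)
      next
        case 3
        then have "graph_cycle G c"
          using True less.prems(1) w by (simp add: graph_cycle_def cycle_edges_subset_iff_walk)
        then show ?thesis using cyc[of c] graph_cycle_sign[of G c s] unfolding w[symmetric] by simp
      qed
    next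
      case False
      then obtain a b d y where abd: "c = a @ [y] @ b @ [y] @ d"
        using not_distinct_decomp[of c] by blast
      \<comment> \<open>The closing vertex goes to the tail \<open>d'\<close>, which is therefore
        nonempty; this makes the loop at \<open>y\<close> strictly shorter than
        \<open>w\<close>.\<close>
      define d' where "d' = d @ [hd c]"
      have w': "w = a @ y # b @ y # d'" and d': "d' \<noteq> []"
        using w abd by (simp_all add: d'_def)
      have "walk G (a @ [y])" "walk G ((y # b) @ y # d')"
        using less.prems(1) walk_append[of G a y "b @ y # d'"] unfolding w' by simp_all
      then have wk: "walk G (a @ [y])" "walk G (y # b @ [y])" "walk G (y # d')"
        using walk_append[of G "y # b" y d'] unfolding append_Cons by blast+
      have "walk_sign s (y # b @ [y]) = 1"
      proof (rule less.hyps)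
        show "length (y # b @ [y]) < length w" using d' by (simp add: w')
      qed (use wk in simp_all)
      moreover have "walk_sign s (a @ y # d') = 1"
      proof (rule less.hyps)
        show "walk G (a @ y # d')" using wk(1,3) by (simp only: walk_append[of G a y d'])
        show "hd (a @ y # d') = last (a @ y # d')"
          using less.prems(3) d' unfolding w' by (cases a) simp_all
      qed (simp_all add: w')
      moreover have "walk_sign s w =
          walk_sign s (a @ [y]) * (walk_sign s (y # b @ [y]) * walk_sign s (y # d'))"
        by (simp only: w' walk_sign_append[of s a y "b @ y # d'"]
            walk_sign_append[of s "y # b" y d', unfolded append_Cons])
      ultimately show ?thesis by (simp only: walk_sign_append[of s a y d'] mult_1)
    qed
  qed
qed

lemma connected_graph_walk:
  assumes "connected_graph G" "u \<in> verts G" "v \<in> verts G"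
  obtains w where "walk G w" "w \<noteq> []" "hd w = u" "last w = v"
proof -
  have "(u, v) \<in> {(x, y). {x, y} \<in> edges G}\<^sup>*"
    using assms unfolding connected_graph_def by blast
  then have "\<exists>w. walk G w \<and> w \<noteq> [] \<and> hd w = u \<and> last w = v"
  proof induction
    case base
    show ?case by (rule exI[of _ "[u]"]) auto
  next
    case (step y z)
    then obtain w where "walk G w" "w \<noteq> []" "hd w = u" "last w = y" by auto
    then show ?case
      using step.hyps(2) by (intro exI[of _ "w @ [z]"]) (auto simp: successively_append_iff)
  qed
  then show ?thesis using that by auto
qed

text \<open>The potential of a vertex is the sign of a chosen walk to it from a root. For an edge
  uv, the walk to u, the edge, and the reversed walk from v close up, so their signs multiply to
  1.\<close>

lemma balanced_potential:
  assumes G: "signed_graph (G, s)" "connected_graph G"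
    and cyc: "\<And>c. graph_cycle G c \<Longrightarrow> cycle_sign s c = 1"
  obtains \<theta> :: "'a \<Rightarrow> int"
  where "\<And>v. \<theta> v \<in> {1, -1}" "\<And>u v. {u, v} \<in> edges G \<Longrightarrow> s {u, v} = \<theta> u * \<theta> v"
proof -
  obtain r where r: "r \<in> verts G" using G(2) by (auto simp: connected_graph_def)
  define P where "P v w \<longleftrightarrow> walk G w \<and> w \<noteq> [] \<and> hd w = r \<and> last w = v" for v w
  define W where "W v = (SOME w. P v w)" for v
  \<comment> \<open>The value 1 off the vertex set makes \<open>\<theta>\<close> a sign function on
    the whole type.\<close>
  define \<theta> where "\<theta> v = (if v \<in> verts G then walk_sign s (W v) else 1)" for v
  have W: "P v (W v)" if "v \<in> verts G" for v
    unfolding W_def using connected_graph_walk[OF G(2) r that]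
    by (metis (mono_tags, lifting) P_def someI)
  have pm: "\<theta> v \<in> {1, -1}" for v
    using W[of v] walk_sign_pm_one[OF G(1), of "W v"] by (auto simp: \<theta>_def P_def)
  have "s {u, v} = \<theta> u * \<theta> v" if e: "{u, v} \<in> edges G" for u v
  proof -
    have uv: "u \<in> verts G" "v \<in> verts G" using signed_graphD(4)[OF G(1) e] by auto
    obtain a where a: "W u = a @ [u]"
      using W[OF uv(1)] by (cases "W u" rule: rev_cases) (auto simp: P_def)
    obtain b where b: "W v = b @ [v]"
      using W[OF uv(2)] by (cases "W v" rule: rev_cases) (auto simp: P_def)
    have wa: "walk G (a @ [u])" and wb: "walk G (v # rev b)"
      using W[OF uv(1)] W[OF uv(2)] a b walk_rev[of G "b @ [v]"] by (auto simp: P_def)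
    let ?w = "a @ u # v # rev b"
    have "walk G ?w" using wa wb e walk_append[of G a u "v # rev b"] by auto
    moreover have "hd ?w = r" using W[OF uv(1)] a by (cases a) (auto simp: P_def)
    moreover have "last ?w = r"
      using W[OF uv(2)] b by (cases b) (auto simp: P_def)
    ultimately have "walk_sign s ?w = 1"
      using closed_walk_sign[OF G(1) cyc, of ?w] by auto
    then have "\<theta> u * (s {u, v} * \<theta> v) = 1"
      using walk_sign_append[of s a u "v # rev b"] walk_sign_rev[of s "b @ [v]"] uv a b
      by (simp add: \<theta>_def)
    then show ?thesis using pm[of u] pm[of v] by auto
  qed
  with pm show ?thesis using that by blast
qed

text \<open>With sign -1 on every edge, the sign of a cycle is the parity of its length. If no cycle
  is odd, balance yields a potential that differs at the ends of every edge, and its two level sets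
  form a bipartition.\<close>

lemma not_bipartite_odd_cycle:
  assumes "simple_graph G" "connected_graph G" "\<not> bipartite G"
  obtains c where "graph_cycle G c" "odd (length c)"
proof (rule ccontr)
  assume contra: "\<not> thesis"
  have ev: "even (length c)" if "graph_cycle G c" for c
    using contra \<open>\<And>c. graph_cycle G c \<Longrightarrow> odd (length c) \<Longrightarrow> thesis\<close> that by blast
  define s :: "'a set \<Rightarrow> int" where "s = (\<lambda>_. -1)"
  have "cycle_sign s c = 1" if "graph_cycle G c" for c
  proof -
    show ?thesis
      using ev[OF that] graph_cycle_sign[OF that, of s] by (simp add: walk_sign_eq_prod s_def)
  qed
  then obtain \<theta> :: "'a \<Rightarrow> int" where \<theta>: "\<And>v. \<theta> v \<in> {1, -1}"
      "\<And>u v. {u, v} \<in> edges G \<Longrightarrow> s {u, v} = \<theta> u * \<theta> v"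
    using balanced_potential[of G s] assms by (auto simp: s_def)
  have "bipartite G"
    unfolding bipartite_def
  proof (intro exI conjI ballI)
    let ?X = "{v \<in> verts G. \<theta> v = 1}" and ?Y = "{v \<in> verts G. \<theta> v \<noteq> 1}"
    show "?X \<union> ?Y = verts G" "?X \<inter> ?Y = {}" by auto
    fix e assume e: "e \<in> edges G"
    then obtain u v where uv: "u \<in> verts G" "v \<in> verts G" "e = {u, v}"
      using assms(1) by (auto simp: simple_graph_def)
    then have "\<theta> u * \<theta> v = -1" using \<theta>(2)[of u v] e by (simp add: s_def)
    then have "\<theta> u = 1 \<and> \<theta> v \<noteq> 1 \<or> \<theta> v = 1 \<and> \<theta> u \<noteq> 1"
      using \<theta>(1)[of u] \<theta>(1)[of v] by auto
    moreover have "e = {v, u}" using uv by (simp add: insert_commute)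
    ultimately show "\<exists>x\<in>?X. \<exists>y\<in>?Y. e = {x, y}"
      using uv by blast
  qed
  with assms(3) show False by simp
qed

section \<open>Switching maps\<close>

text \<open>In matrix form, \<open>f\<close> carries the adjacency matrix of \<Gamma>, conjugated by
  the diagonal matrix of \<open>\<theta>\<close>, to that of \<Gamma>'. The signs live on the source
  and on its whole type, so that composites need no case distinction.\<close>

definition switching_map ::
  "('a \<Rightarrow> 'b) \<Rightarrow> ('a \<Rightarrow> int) \<Rightarrow> 'a signed_graph \<Rightarrow> 'b signed_graph \<Rightarrow> bool" where
  "switching_map f \<theta> \<Gamma> \<Gamma>' \<longleftrightarrow> bij_betw f (verts (fst \<Gamma>)) (verts (fst \<Gamma>')) \<and>
     (\<forall>v. \<theta> v \<in> {1, -1}) \<and>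
     (\<forall>u\<in>verts (fst \<Gamma>). \<forall>v\<in>verts (fst \<Gamma>).
        adjacency \<Gamma>' (f u) (f v) = \<theta> u * \<theta> v * adjacency \<Gamma> u v)"

section \<open>Adjacency entries under negation, switching and isomorphism\<close>

lemma adjacency_commute: "adjacency \<Gamma> u v = adjacency \<Gamma> v u"
  by (cases \<Gamma>) (simp add: insert_commute)

lemma adjacency_range: "signed_graph \<Gamma> \<Longrightarrow> adjacency \<Gamma> u v \<in> {0, 1, -1}"
  by (cases \<Gamma>) auto

lemma adjacency_eq_0_iff:
  "signed_graph \<Gamma> \<Longrightarrow> adjacency \<Gamma> u v = 0 \<longleftrightarrow> {u, v} \<notin> edges (fst \<Gamma>)"
  by (cases \<Gamma>) auto

lemma adjacency_diag: "signed_graph \<Gamma> \<Longrightarrow> adjacency \<Gamma> u u = 0"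
  using signed_graphD(4)[of "fst \<Gamma>" "snd \<Gamma>" u u] by (cases \<Gamma>) auto

lemma adjacency_neg_signed: "adjacency (neg_signed \<Gamma>) u v = - adjacency \<Gamma> u v"
  by (cases \<Gamma>) simp

lemma fst_neg_signed [simp]: "fst (neg_signed \<Gamma>) = fst \<Gamma>"
  by (cases \<Gamma>) simp

lemma signed_graph_neg_signed: "signed_graph \<Gamma> \<Longrightarrow> signed_graph (neg_signed \<Gamma>)"
  by (cases \<Gamma>) auto

lemma fst_switching [simp]: "fst (switching U \<Gamma>) = fst \<Gamma>"
  by (cases \<Gamma>) simp

lemma signed_graph_switching: "signed_graph \<Gamma> \<Longrightarrow> signed_graph (switching U \<Gamma>)"
  by (cases \<Gamma>) auto

text \<open>An edge is reversed when exactly one of its ends lies in \<open>U\<close>, that is, when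
  the two end signs multiply to -1.\<close>

lemma adjacency_switching:
  assumes "u \<in> verts (fst \<Gamma>)" "v \<in> verts (fst \<Gamma>)"
  shows "adjacency (switching U \<Gamma>) u v =
    (if u \<in> U then -1 else 1) * (if v \<in> U then -1 else 1) * adjacency \<Gamma> u v"
proof -
  obtain G \<sigma> where \<Gamma>: "\<Gamma> = (G, \<sigma>)" by (cases \<Gamma>)
  have "(\<exists>x\<in>U. \<exists>y\<in>verts G - U. {u, v} = {x, y}) \<longleftrightarrow> (u \<in> U \<longleftrightarrow> v \<notin> U)"
    using assms by (auto simp: doubleton_eq_iff \<Gamma>)
  then show ?thesis by (simp add: \<Gamma>)
qed

text \<open>Signs of edges are nonzero, so the adjacency entries determine both the edges and their
  signs.\<close>

lemma signed_iso_iff_adjacency: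
  assumes "signed_graph \<Gamma>" "signed_graph \<Gamma>'"
  shows "signed_iso f \<Gamma> \<Gamma>' \<longleftrightarrow> bij_betw f (verts (fst \<Gamma>)) (verts (fst \<Gamma>')) \<and>
    (\<forall>u\<in>verts (fst \<Gamma>). \<forall>v\<in>verts (fst \<Gamma>). adjacency \<Gamma>' (f u) (f v) = adjacency \<Gamma> u v)"
    (is "?l \<longleftrightarrow> ?r")
proof -
  obtain G \<sigma> H \<tau> where \<Gamma>: "\<Gamma> = (G, \<sigma>)" "\<Gamma>' = (H, \<tau>)" by (cases \<Gamma>, cases \<Gamma>')
  show ?thesis
  proof
    assume ?l
    then show ?r by (auto simp: \<Gamma>) (metis image_empty image_insert)
  next
    assume r: ?r
    have edge: "{u, v} \<in> edges G \<longleftrightarrow> {f u, f v} \<in> edges H"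
      if "u \<in> verts G" "v \<in> verts G" for u v
      using r that adjacency_eq_0_iff[OF assms(1), of u v]
        adjacency_eq_0_iff[OF assms(2), of "f u" "f v"] by (simp add: \<Gamma>)
    have "\<tau> (f ` e) = \<sigma> e" if "e \<in> edges G" for e
    proof -
      obtain u v where "u \<in> verts G" "v \<in> verts G" "e = {u, v}"
        using assms(1) simple_graph_edgeE[OF _ \<open>e \<in> edges G\<close>] unfolding \<Gamma> signed_graph.simps by metis
      moreover from this have "adjacency \<Gamma>' (f u) (f v) = adjacency \<Gamma> u v"
        using r by (simp only: \<Gamma> fst_conv)
      ultimately show ?thesis using edge[of u v] that by (simp add: \<Gamma>)
    qed
    with edge r show ?l by (auto simp: \<Gamma>)
  qed
qed

text \<open>The switching set lies in the target, the sign function on the source: among the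
  vertices of \<Gamma>, \<open>\<theta>\<close> is -1 exactly on those that \<open>f\<close> sends
  into \<open>U\<close>.\<close>

lemma switching_isomorphic_iff:
  assumes "signed_graph \<Gamma>" "signed_graph \<Gamma>'"
  shows "\<Gamma> \<simeq>\<^sub>s \<Gamma>' \<longleftrightarrow> (\<exists>f \<theta>. switching_map f \<theta> \<Gamma> \<Gamma>')"
proof
  assume "\<Gamma> \<simeq>\<^sub>s \<Gamma>'"
  then obtain U f where "signed_iso f \<Gamma> (switching U \<Gamma>')"
    by (auto simp: switching_isomorphic_def)
  then have bij: "bij_betw f (verts (fst \<Gamma>)) (verts (fst \<Gamma>'))"
    and adj: "\<forall>u\<in>verts (fst \<Gamma>). \<forall>v\<in>verts (fst \<Gamma>).
      adjacency (switching U \<Gamma>') (f u) (f v) = adjacency \<Gamma> u v"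
    using assms by (auto simp: signed_iso_iff_adjacency signed_graph_switching)
  let ?\<theta> = "\<lambda>v. if f v \<in> U then -1 else 1 :: int"
  have "adjacency \<Gamma>' (f u) (f v) = ?\<theta> u * ?\<theta> v * adjacency \<Gamma> u v"
    if "u \<in> verts (fst \<Gamma>)" "v \<in> verts (fst \<Gamma>)" for u v
    using adj that adjacency_switching[of "f u" \<Gamma>' "f v" U] bij_betwE[OF bij]
    by (auto split: if_splits)
  then have "switching_map f ?\<theta> \<Gamma> \<Gamma>'"
    using bij by (simp add: switching_map_def)
  then show "\<exists>f \<theta>. switching_map f \<theta> \<Gamma> \<Gamma>'" by blast
next
  assume "\<exists>f \<theta>. switching_map f \<theta> \<Gamma> \<Gamma>'"
  then obtain f \<theta> where f: "switching_map f \<theta> \<Gamma> \<Gamma>'" by blast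
  define U where "U = f ` {v \<in> verts (fst \<Gamma>). \<theta> v = -1}"
  have bij: "bij_betw f (verts (fst \<Gamma>)) (verts (fst \<Gamma>'))"
    using f by (simp add: switching_map_def)
  have U: "(if f v \<in> U then -1 else 1) = \<theta> v" if "v \<in> verts (fst \<Gamma>)" for v
    using f that unfolding U_def switching_map_def bij_betw_def inj_on_def by auto
  have "adjacency (switching U \<Gamma>') (f u) (f v) = adjacency \<Gamma> u v"
    if "u \<in> verts (fst \<Gamma>)" "v \<in> verts (fst \<Gamma>)" for u v
  proof -
    have "adjacency (switching U \<Gamma>') (f u) (f v) = \<theta> u * \<theta> v * (\<theta> u * \<theta> v * adjacency \<Gamma> u v)"
      using that bij_betwE[OF bij] f U by (simp add: adjacency_switching switching_map_def)
    also have "\<dots> = (\<theta> u * \<theta> u) * (\<theta> v * \<theta> v) * adjacency \<Gamma> u v" by (simp only: ac_simps)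
    also have "\<dots> = adjacency \<Gamma> u v"
      using f pm_one_square[of "\<theta> u"] pm_one_square[of "\<theta> v"] by (simp add: switching_map_def)
    finally show ?thesis .
  qed
  then have "signed_iso f \<Gamma> (switching U \<Gamma>')"
    using assms bij by (simp add: signed_iso_iff_adjacency signed_graph_switching)
  moreover have "U \<subseteq> verts (fst \<Gamma>')" using bij by (auto simp: U_def bij_betw_def)
  ultimately show "\<Gamma> \<simeq>\<^sub>s \<Gamma>'" unfolding switching_isomorphic_def by blast
qed

section \<open>Composition, inversion and negation of switching maps\<close>

lemma switching_map_comp:
  assumes "switching_map f \<theta> \<Gamma>\<^sub>1 \<Gamma>\<^sub>2" "switching_map g \<eta> \<Gamma>\<^sub>2 \<Gamma>\<^sub>3"
  shows "switching_map (g \<circ> f) (\<lambda>v. \<theta> v * \<eta> (f v)) \<Gamma>\<^sub>1 \<Gamma>\<^sub>3"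
proof -
  have pm: "\<theta> v \<in> {1, -1}" "\<eta> w \<in> {1, -1}" for v w
    using assms by (auto simp: switching_map_def)
  have "\<theta> v * \<eta> (f v) \<in> {1, -1}" for v
    using pm(1)[of v] pm(2)[of "f v"] by auto
  moreover have "bij_betw (g \<circ> f) (verts (fst \<Gamma>\<^sub>1)) (verts (fst \<Gamma>\<^sub>3))"
    using assms by (auto simp: switching_map_def intro: bij_betw_trans)
  moreover have "f u \<in> verts (fst \<Gamma>\<^sub>2)" if "u \<in> verts (fst \<Gamma>\<^sub>1)" for u
    using assms(1) that by (auto simp: switching_map_def bij_betw_def)
  ultimately show ?thesis
    using assms unfolding switching_map_def by simp
qed

lemma switching_map_inv_into:
  assumes "switching_map f \<theta> \<Gamma> \<Gamma>'"
  shows "switching_map (inv_into (verts (fst \<Gamma>)) f) (\<theta> \<circ> inv_into (verts (fst \<Gamma>)) f) \<Gamma>' \<Gamma>"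
proof -
  let ?g = "inv_into (verts (fst \<Gamma>)) f"
  have bij: "bij_betw f (verts (fst \<Gamma>)) (verts (fst \<Gamma>'))" and pm: "\<And>v. \<theta> v \<in> {1, -1}"
    using assms by (auto simp: switching_map_def)
  have "adjacency \<Gamma> (?g x) (?g y) = \<theta> (?g x) * \<theta> (?g y) * adjacency \<Gamma>' x y"
    if "x \<in> verts (fst \<Gamma>')" "y \<in> verts (fst \<Gamma>')" for x y
  proof -
    have "adjacency \<Gamma>' (f (?g x)) (f (?g y)) = \<theta> (?g x) * \<theta> (?g y) * adjacency \<Gamma> (?g x) (?g y)"
      using that bij_betwE[OF bij_betw_inv_into[OF bij]] assms by (simp add: switching_map_def)
    then have "adjacency \<Gamma>' x y = \<theta> (?g x) * \<theta> (?g y) * adjacency \<Gamma> (?g x) (?g y)"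
      using that bij by (simp add: bij_betw_inv_into_right)
    then show ?thesis using pm[of "?g x"] pm[of "?g y"] by auto
  qed
  then show ?thesis
    using bij_betw_inv_into[OF bij] pm by (simp add: switching_map_def)
qed

lemma switching_map_neg_signed:
  "switching_map f \<theta> \<Gamma> \<Gamma>' \<Longrightarrow> switching_map f \<theta> (neg_signed \<Gamma>) (neg_signed \<Gamma>')"
  by (simp add: switching_map_def adjacency_neg_signed)

text \<open>For replacing a composite by a function that is the identity off the vertex set, as
  \<open>permutes\<close> demands.\<close>

lemma switching_map_cong:
  assumes "switching_map f \<theta> \<Gamma> \<Gamma>'" "\<And>v. v \<in> verts (fst \<Gamma>) \<Longrightarrow> g v = f v"
  shows "switching_map g \<theta> \<Gamma> \<Gamma>'"
  using assms by (simp add: switching_map_def cong: bij_betw_cong)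

section \<open>Weak automorphisms as switching maps\<close>

text \<open>Each edge contributes a factor -1 and the values of \<open>\<theta>\<close> at its ends.
  Values at interior positions appear squared, so only the ends of the walk and the number of edges
  remain.\<close>

lemma walk_sign_switching:
  assumes "\<And>u v. {u, v} \<in> edges G \<Longrightarrow> \<sigma> {\<phi> u, \<phi> v} = - (\<theta> u * \<theta> v * \<sigma> {u, v})"
    and "\<And>v. \<theta> v \<in> {1, -1 :: int}"
  shows "walk G w \<Longrightarrow> w \<noteq> [] \<Longrightarrow>
    walk_sign \<sigma> (map \<phi> w) = (-1) ^ (length w - 1) * (\<theta> (hd w) * \<theta> (last w) * walk_sign \<sigma> w)"
proof (induction w rule: induct_list012)
  case (3 x y zs)
  have "walk_sign \<sigma> (map \<phi> (x # y # zs)) = - (\<theta> x * \<theta> y * \<sigma> {x, y}) *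
      ((-1) ^ length zs * (\<theta> y * \<theta> (last (y # zs)) * walk_sign \<sigma> (y # zs)))"
    using 3 assms(1)[of x y] by simp
  also have "\<dots> = (\<theta> y * \<theta> y) * ((-1) ^ Suc (length zs) *
      (\<theta> x * \<theta> (last (y # zs)) * (\<sigma> {x, y} * walk_sign \<sigma> (y # zs))))"
    by (simp add: ac_simps)
  finally show ?case using pm_one_square[OF assms(2)[of y]] by simp
qed (use assms(2) pm_one_square in auto)

text \<open>Give every edge the negated product of its own sign and the sign of its image. The cycle
  conditions make this signature positive on every cycle, and its potential is
  \<open>\<theta>\<close>. Conversely, around a cycle the factors \<open>\<theta>\<close> cancel,
  and the power of -1 separates the two parities.\<close>

lemma weak_automorphism_iff_switching_map:
  assumes G: "signed_graph (G, \<sigma>)" "connected_graph G"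
  shows "weak_automorphism (G, \<sigma>) \<phi> \<longleftrightarrow>
    \<phi> permutes verts G \<and> (\<exists>\<theta>. switching_map \<phi> \<theta> (G, \<sigma>) (neg_signed (G, \<sigma>)))"
proof (intro iffI conjI)
  assume wa: "weak_automorphism (G, \<sigma>) \<phi>"
  then show perm: "\<phi> permutes verts G" by (simp add: Aut_def)
  have edge: "{u, v} \<in> edges G \<longleftrightarrow> {\<phi> u, \<phi> v} \<in> edges G"
    if "u \<in> verts G" "v \<in> verts G" for u v
    using wa that by (simp add: Aut_def)
  define s where "s e = - (\<sigma> e * \<sigma> (\<phi> ` e))" for e
  have "s e \<in> {1, -1}" if "e \<in> edges G" for e
  proof -
    obtain u v where uv: "u \<in> verts G" "v \<in> verts G" "e = {u, v}"
      using simple_graph_edgeE[OF signed_graphD(1)[OF G(1)] \<open>e \<in> edges G\<close>] by metis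
    then show ?thesis
      using signed_graphD(3)[OF G(1), of e] signed_graphD(3)[OF G(1), of "{\<phi> u, \<phi> v}"]
        edge[of u v] that by (auto simp: s_def)
  qed
  then have Gs: "signed_graph (G, s)" using G by simp
  have mult: "walk_sign s w = (-1) ^ (length w - 1) * (walk_sign \<sigma> w * walk_sign \<sigma> (map \<phi> w))" for w
    by (induction w rule: induct_list012) (auto simp: s_def)
  have "cycle_sign s c = 1" if c: "graph_cycle G c" for c
  proof -
    have "cycle_sign \<sigma> (map \<phi> c) = walk_sign \<sigma> (map \<phi> (c @ [hd c]))"
      by (rule cycle_sign_map[OF permutes_inj[OF perm] c])
    then have "cycle_sign s c = (-1) ^ length c * (cycle_sign \<sigma> c * cycle_sign \<sigma> (map \<phi> c))"
      using mult[of "c @ [hd c]"] c by (simp add: graph_cycle_sign)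
    \<comment> \<open>Both parities of the cycle condition in one formula; the same power of -1
      comes from the minus signs in \<open>s\<close>, and the two cancel.\<close>
    moreover have "cycle_sign \<sigma> (map \<phi> c) = (-1) ^ length c * cycle_sign \<sigma> c"
      using wa c by (cases "even (length c)") auto
    moreover have "cycle_sign \<sigma> c * cycle_sign \<sigma> c = 1"
      using walk_sign_pm_one[OF G(1) graph_cycle_walk[OF c]] pm_one_square
      by (simp add: graph_cycle_sign[OF c])
    ultimately show ?thesis by (cases "even (length c)") simp_all
  qed
  then obtain \<theta> :: "'a \<Rightarrow> int" where \<theta>: "\<And>v. \<theta> v \<in> {1, -1}"
      "\<And>u v. {u, v} \<in> edges G \<Longrightarrow> s {u, v} = \<theta> u * \<theta> v"
    using balanced_potential[OF Gs G(2)] by blast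
  have "adjacency (neg_signed (G, \<sigma>)) (\<phi> u) (\<phi> v) = \<theta> u * \<theta> v * adjacency (G, \<sigma>) u v"
    if uv: "u \<in> verts G" "v \<in> verts G" for u v
  proof (cases "{u, v} \<in> edges G")
    case True
    have "\<theta> u * \<theta> v * \<sigma> {u, v} = - (\<sigma> {u, v} * \<sigma> {u, v}) * \<sigma> {\<phi> u, \<phi> v}"
      using \<theta>(2)[OF True, symmetric] by (simp add: s_def)
    also have "\<dots> = - \<sigma> {\<phi> u, \<phi> v}"
      using pm_one_square[OF signed_graphD(3)[OF G(1) True]] by simp
    finally show ?thesis using True edge[OF uv] by simp
  next
    case False
    then show ?thesis using edge[OF uv] by simp
  qed
  then show "\<exists>\<theta>. switching_map \<phi> \<theta> (G, \<sigma>) (neg_signed (G, \<sigma>))"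
    using \<theta>(1) permutes_imp_bij[OF perm] unfolding switching_map_def by auto
next
  assume "\<phi> permutes verts G \<and> (\<exists>\<theta>. switching_map \<phi> \<theta> (G, \<sigma>) (neg_signed (G, \<sigma>)))"
  then obtain \<theta> where perm: "\<phi> permutes verts G"
    and \<theta>: "switching_map \<phi> \<theta> (G, \<sigma>) (neg_signed (G, \<sigma>))" by blast
  have pm: "\<And>v. \<theta> v \<in> {1, -1}" using \<theta> by (simp add: switching_map_def)
  have adj: "adjacency (G, \<sigma>) (\<phi> u) (\<phi> v) = - (\<theta> u * \<theta> v * adjacency (G, \<sigma>) u v)"
    if "u \<in> verts G" "v \<in> verts G" for u v
  proof -
    have "- adjacency (G, \<sigma>) (\<phi> u) (\<phi> v) = \<theta> u * \<theta> v * adjacency (G, \<sigma>) u v"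
      using \<theta> that unfolding switching_map_def adjacency_neg_signed by simp
    then show ?thesis by linarith
  qed
  have edge: "{u, v} \<in> edges G \<longleftrightarrow> {\<phi> u, \<phi> v} \<in> edges G"
    if uv: "u \<in> verts G" "v \<in> verts G" for u v
  proof -
    \<comment> \<open>Nonzero factors preserve the vanishing of entries, so \<open>\<phi>\<close>
      preserves edges and non-edges.\<close>
    have "\<theta> u \<noteq> 0" "\<theta> v \<noteq> 0" using pm[of u] pm[of v] by auto
    then have "adjacency (G, \<sigma>) (\<phi> u) (\<phi> v) = 0 \<longleftrightarrow> adjacency (G, \<sigma>) u v = 0"
      using adj[OF uv] by simp
    then show ?thesis unfolding adjacency_eq_0_iff[OF G(1)] by simp
  qed
  have sw: "\<sigma> {\<phi> u, \<phi> v} = - (\<theta> u * \<theta> v * \<sigma> {u, v})" if e: "{u, v} \<in> edges G" for u v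
  proof -
    have uv: "u \<in> verts G" "v \<in> verts G" using signed_graphD(4)[OF G(1) e] by simp_all
    then show ?thesis using adj[OF uv] edge[OF uv] e by simp
  qed
  have "cycle_sign \<sigma> (map \<phi> c) = (-1) ^ length c * cycle_sign \<sigma> c"
    if c: "graph_cycle G c" for c
  proof -
    have "c \<noteq> []" using c by (auto simp: graph_cycle_def)
    have "cycle_sign \<sigma> (map \<phi> c) = walk_sign \<sigma> (map \<phi> (c @ [hd c]))"
      by (rule cycle_sign_map[OF permutes_inj[OF perm] c])
    also have "\<dots> = (-1) ^ length c * (\<theta> (hd c) * \<theta> (hd c) * walk_sign \<sigma> (c @ [hd c]))"
      using walk_sign_switching[where \<sigma> = \<sigma> and \<phi> = \<phi> and \<theta> = \<theta>, OF sw pm graph_cycle_walk[OF c]]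
        \<open>c \<noteq> []\<close> by simp
    finally show ?thesis
      by (simp add: pm_one_square[OF pm] graph_cycle_sign[OF c])
  qed
  then show "weak_automorphism (G, \<sigma>) \<phi>"
    using perm edge by (simp add: Aut_def)
qed

section \<open>Orders of permutations\<close>

lemma perm_order_eq_2:
  assumes "\<phi> \<circ> \<phi> = id" "\<phi> \<noteq> id"
  shows "perm_order \<phi> = 2"
  unfolding perm_order_def
proof (rule Least_equality)
  show "0 < (2::nat) \<and> \<phi> ^^ 2 = id" using assms(1) by (simp add: numeral_2_eq_2)
  fix n :: nat assume "0 < n \<and> \<phi> ^^ n = id"
  then show "2 \<le> n" using assms(2) by (cases "n = 1") auto
qed

text \<open>The \<open>LEAST\<close> in \<open>perm_order\<close> has meaning only if some positive
  power is the identity; finiteness of the set supplies one.\<close>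

lemma perm_order_properties:
  assumes "\<phi> permutes S" "finite S"
  shows "0 < perm_order \<phi>" "\<phi> ^^ perm_order \<phi> = id"
proof -
  have "permutation \<phi>" using assms by (auto simp: permutation_permutes)
  then obtain n where "\<phi> ^^ n = id" "n > 0" using permutation_is_nilpotent by blast
  then have "\<exists>n. 0 < n \<and> \<phi> ^^ n = id" by blast
  from LeastI_ex[OF this] show "0 < perm_order \<phi>" "\<phi> ^^ perm_order \<phi> = id"
    by (simp_all add: perm_order_def)
qed

lemma perm_order_id: "perm_order id = 1"
  unfolding perm_order_def by (rule Least_equality) auto

lemma perm_order_eq_2_iff:
  assumes "\<phi> permutes S" "finite S"
  shows "perm_order \<phi> = 2 \<longleftrightarrow> \<phi> \<circ> \<phi> = id \<and> \<phi> \<noteq> id"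
  using perm_order_properties(2)[OF assms] perm_order_eq_2[of \<phi>]
  by (auto simp: perm_order_id numeral_2_eq_2)

lemma perm_order_ge_2:
  assumes "\<phi> permutes S" "finite S" "\<phi> \<noteq> id"
  shows "2 \<le> perm_order \<phi>"
proof -
  have "perm_order \<phi> \<noteq> 1" using perm_order_properties(2)[OF assms(1,2)] assms(3) by auto
  then show ?thesis using perm_order_properties(1)[OF assms(1,2)] by linarith
qed

text \<open>An involution is its own inverse, which gives the unique preimages that
  \<open>permutes\<close> requires.\<close>

lemma involution_permutes:
  assumes "\<And>x. \<phi> (\<phi> x) = x" "\<And>x. x \<notin> S \<Longrightarrow> \<phi> x = x"
  shows "\<phi> permutes S"
  unfolding permutes_def using assms by metis

section \<open>The block form\<close>

lemma adj_block_dim [simp]: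
  "dim_row (adj_block \<Gamma> us vs) = length us" "dim_col (adj_block \<Gamma> us vs) = length vs"
  by (simp_all add: adj_block_def)

lemma adj_block_nth [simp]:
  "i < length us \<Longrightarrow> j < length vs \<Longrightarrow> adj_block \<Gamma> us vs $$ (i, j) = adjacency \<Gamma> (us ! i) (vs ! j)"
  by (simp add: adj_block_def)

lemma adj_block_carrier: "adj_block \<Gamma> us vs \<in> carrier_mat (length us) (length vs)"
  by (rule carrier_matI) (rule adj_block_dim)+

lemma elements_adj_block:
  assumes "signed_graph \<Gamma>"
  shows "elements_mat (adj_block \<Gamma> us vs) \<subseteq> {0, 1, -1}"
proof
  fix x assume "x \<in> elements_mat (adj_block \<Gamma> us vs)"
  then obtain i j where "i < length us" "j < length vs" "x = adj_block \<Gamma> us vs $$ (i, j)"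
    using elements_matD by fastforce
  then show "x \<in> {0, 1, -1}" using adjacency_range[OF assms, of "us ! i" "vs ! j"] by simp
qed

lemma adj_block_transpose: "(adj_block \<Gamma> us vs)\<^sup>T = adj_block \<Gamma> vs us"
  by (intro eq_matI) (simp_all add: adjacency_commute)

lemma adj_block_append:
  "adj_block \<Gamma> (us @ us') (vs @ vs') = four_block_mat (adj_block \<Gamma> us vs) (adj_block \<Gamma> us vs')
     (adj_block \<Gamma> us' vs) (adj_block \<Gamma> us' vs')"
  by (intro eq_matI) (auto simp: nth_append)

text \<open>Choosing one vertex from every two-element orbit already gives a block form with a single
  pair of blocks, \<open>s = 1\<close> and \<open>m = 0\<close>.\<close>

lemma block_form_of_involution:
  assumes \<Gamma>: "signed_graph \<Gamma>"
    and sm: "switching_map \<phi> \<theta> \<Gamma> (neg_signed \<Gamma>)"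
    and perm: "\<phi> permutes verts (fst \<Gamma>)" "\<And>v. \<phi> (\<phi> v) = v" "\<phi> \<noteq> id"
    and fixed: "v\<^sub>0 \<in> verts (fst \<Gamma>)" "\<phi> v\<^sub>0 = v\<^sub>0"
    and \<theta>: "\<And>v. v \<in> verts (fst \<Gamma>) \<Longrightarrow> \<phi> v \<noteq> v \<Longrightarrow> \<theta> v = 1"
  shows "block_form \<Gamma>"
proof -
  let ?V = "verts (fst \<Gamma>)"
  have fin: "finite ?V" using \<Gamma> by (cases \<Gamma>) (auto simp: simple_graph_def)
  \<comment> \<open>The labelling breaks the symmetry inside a two-element orbit: \<open>T\<close>
    takes the vertex with the smaller label, and the strict inequality leaves out the fixed
    vertices.\<close>
  obtain h :: "'a \<Rightarrow> nat" where h: "inj_on h ?V" using finite_imp_inj_to_nat_seg[OF fin] by blast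
  have \<phi>V: "\<phi> v \<in> ?V \<longleftrightarrow> v \<in> ?V" for v using permutes_in_image[OF perm(1)] .
  define T where "T = {v \<in> ?V. h v < h (\<phi> v)}"
  define W1 where "W1 = {v \<in> ?V. \<phi> v = v \<and> \<theta> v = 1}"
  define W2 where "W2 = {v \<in> ?V. \<phi> v = v \<and> \<theta> v \<noteq> 1}"
  have "finite T" "finite W1" "finite W2" using fin by (simp_all add: T_def W1_def W2_def)
  then obtain us xs ys where us: "set us = T" "distinct us" and xs: "set xs = W1" "distinct xs"
    and ys: "set ys = W2" "distinct ys" by (metis finite_distinct_list)
  \<comment> \<open>Listing the second block as the image of the first aligns their orders, so that
    \<open>\<phi>\<close> exchanges equal positions.\<close>
  let ?us' = "map \<phi> us"
  have pm: "\<theta> v \<in> {1, -1}" for v using sm by (simp add: switching_map_def)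
  have adj: "adjacency \<Gamma> (\<phi> u) (\<phi> v) = - (\<theta> u * \<theta> v * adjacency \<Gamma> u v)"
    if "u \<in> ?V" "v \<in> ?V" for u v
  proof -
    have "- adjacency \<Gamma> (\<phi> u) (\<phi> v) = \<theta> u * \<theta> v * adjacency \<Gamma> u v"
      using sm that unfolding switching_map_def adjacency_neg_signed by simp
    then show ?thesis by linarith
  qed
  have T: "v \<in> ?V" "\<phi> v \<in> ?V" "\<theta> v = 1" "\<theta> (\<phi> v) = 1" if "v \<in> T" for v
  proof -
    show v: "v \<in> ?V" "\<phi> v \<in> ?V" using that \<phi>V by (simp_all add: T_def)
    have ne: "\<phi> v \<noteq> v" using that by (auto simp: T_def)
    show "\<theta> v = 1" using \<theta>[OF v(1) ne] .
    show "\<theta> (\<phi> v) = 1" using \<theta>[OF v(2)] ne perm(2)[of v] by simp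
  qed
  have W1: "v \<in> ?V" "\<phi> v = v" "\<theta> v = 1" if "v \<in> W1" for v using that by (simp_all add: W1_def)
  have W2: "v \<in> ?V" "\<phi> v = v" "\<theta> v = -1" if "v \<in> W2" for v
    using that pm[of v] by (auto simp: W2_def)
  have nonfixed: "v \<in> T \<union> \<phi> ` T" if v: "v \<in> ?V" "\<phi> v \<noteq> v" for v
  proof -
    have "h v \<noteq> h (\<phi> v)" using h v \<phi>V[of v] unfolding inj_on_def by metis
    then consider "h v < h (\<phi> v)" | "h (\<phi> v) < h v" by linarith
    then show ?thesis
    proof cases
      case 1
      then show ?thesis using v by (simp add: T_def)
    next
      case 2
      then have "\<phi> v \<in> T" using v \<phi>V perm(2) by (simp add: T_def)
      then have "\<phi> (\<phi> v) \<in> \<phi> ` T" by (rule imageI)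
      then show ?thesis using perm(2) by simp
    qed
  qed
  have V: "W1 \<union> W2 \<union> (T \<union> \<phi> ` T) = ?V"
  proof
    show "W1 \<union> W2 \<union> (T \<union> \<phi> ` T) \<subseteq> ?V" using T W1 W2 by blast
    show "?V \<subseteq> W1 \<union> W2 \<union> (T \<union> \<phi> ` T)"
      using nonfixed unfolding W1_def W2_def by blast
  qed
  have disj: "W1 \<inter> W2 = {}" "(W1 \<union> W2) \<inter> (T \<union> \<phi> ` T) = {}" "T \<inter> \<phi> ` T = {}"
    using perm(2) by (auto simp: W1_def W2_def T_def)
  have "inj_on \<phi> T" using permutes_inj[OF perm(1)] by (rule inj_on_subset) simp
  then have dist: "distinct (xs @ ys @ us @ ?us')"
    using us xs ys disj by (auto simp: distinct_map)
  obtain w where "\<phi> w \<noteq> w" using perm(3) by (auto simp: fun_eq_iff)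
  moreover from this have "w \<in> ?V" using permutes_not_in[OF perm(1)] by blast
  ultimately have "us \<noteq> []" using nonfixed us by auto
  have Tn: "us ! i \<in> T" if "i < length us" for i using that us nth_mem by blast
  have W1n: "xs ! i \<in> W1" if "i < length xs" for i using that xs nth_mem by blast
  have W2n: "ys ! i \<in> W2" if "i < length ys" for i using that ys nth_mem by blast
  \<comment> \<open>Two fixed vertices with equal signs have an entry equal to its own negative. For
    opposite signs the identity is trivial, which leaves the block between \<open>W1\<close> and
    \<open>W2\<close> arbitrary.\<close>
  have 11: "adj_block \<Gamma> xs xs = 0\<^sub>m (length xs) (length xs)"
  proof (intro eq_matI)
    fix i j assume ij: "i < dim_row (0\<^sub>m (length xs) (length xs) :: int mat)"
      "j < dim_col (0\<^sub>m (length xs) (length xs) :: int mat)"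
    then show "adj_block \<Gamma> xs xs $$ (i, j) = 0\<^sub>m (length xs) (length xs) $$ (i, j)"
      using adj[of "xs ! i" "xs ! j"] W1[OF W1n[of i]] W1[OF W1n[of j]] by simp
  qed simp_all
  have 22: "adj_block \<Gamma> ys ys = 0\<^sub>m (length ys) (length ys)"
  proof (intro eq_matI)
    fix i j assume ij: "i < dim_row (0\<^sub>m (length ys) (length ys) :: int mat)"
      "j < dim_col (0\<^sub>m (length ys) (length ys) :: int mat)"
    then show "adj_block \<Gamma> ys ys $$ (i, j) = 0\<^sub>m (length ys) (length ys) $$ (i, j)"
      using adj[of "ys ! i" "ys ! j"] W2[OF W2n[of i]] W2[OF W2n[of j]] by simp
  qed simp_all
  \<comment> \<open>Moved vertices carry sign 1, so passing from a vertex of \<open>T\<close> to its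
    image multiplies the entry by minus the sign of the fixed vertex. This is the pattern of the
    indices above \<open>m\<close>.\<close>
  have 1: "adj_block \<Gamma> xs ?us' = - adj_block \<Gamma> xs us"
  proof (intro eq_matI)
    fix i j assume ij: "i < dim_row (- adj_block \<Gamma> xs us)" "j < dim_col (- adj_block \<Gamma> xs us)"
    then show "adj_block \<Gamma> xs ?us' $$ (i, j) = (- adj_block \<Gamma> xs us) $$ (i, j)"
      using adj[of "xs ! i" "us ! j"] W1[OF W1n[of i]] T[OF Tn[of j]] by simp
  qed simp_all
  have 2: "adj_block \<Gamma> ys ?us' = adj_block \<Gamma> ys us"
  proof (intro eq_matI)
    fix i j assume ij: "i < dim_row (adj_block \<Gamma> ys us)" "j < dim_col (adj_block \<Gamma> ys us)"
    then show "adj_block \<Gamma> ys ?us' $$ (i, j) = adj_block \<Gamma> ys us $$ (i, j)"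
      using adj[of "ys ! i" "us ! j"] W2[OF W2n[of i]] T[OF Tn[of j]] by simp
  qed simp_all
  have B: "adj_block \<Gamma> ?us' ?us' = - adj_block \<Gamma> us us"
  proof (intro eq_matI)
    fix i j assume ij: "i < dim_row (- adj_block \<Gamma> us us)" "j < dim_col (- adj_block \<Gamma> us us)"
    then show "adj_block \<Gamma> ?us' ?us' $$ (i, j) = (- adj_block \<Gamma> us us) $$ (i, j)"
      using adj[of "us ! i" "us ! j"] T[OF Tn[of i]] T[OF Tn[of j]] by simp
  qed simp_all
  \<comment> \<open>The identity is applied to \<open>us ! i\<close> and
    \<open>\<phi> (us ! j)\<close>; the second application of \<open>\<phi>\<close> returns to
    \<open>us ! j\<close>.\<close>
  have Y: "adj_block \<Gamma> ?us' us = - adj_block \<Gamma> us ?us'"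
  proof (intro eq_matI)
    fix i j assume ij: "i < dim_row (- adj_block \<Gamma> us ?us')" "j < dim_col (- adj_block \<Gamma> us ?us')"
    then show "adj_block \<Gamma> ?us' us $$ (i, j) = (- adj_block \<Gamma> us ?us') $$ (i, j)"
      using adj[of "us ! i" "\<phi> (us ! j)"] T[OF Tn[of i]] T[OF Tn[of j]] perm(2)[of "us ! j"] by simp
  qed simp_all
  show ?thesis
    unfolding block_form_def
  proof (rule exI[of _ 1], rule exI[of _ 0], rule exI[of _ xs], rule exI[of _ ys],
      rule exI[of _ "\<lambda>_. us"], rule exI[of _ "\<lambda>_. ?us'"],
      rule exI[of _ "adj_block \<Gamma> xs ys"], rule exI[of _ "\<lambda>_. adj_block \<Gamma> xs us"],
      rule exI[of _ "\<lambda>_. adj_block \<Gamma> ys us"], rule exI[of _ "\<lambda>_. adj_block \<Gamma> us us"],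
      rule exI[of _ "\<lambda>_. adj_block \<Gamma> us ?us'"], intro conjI)
    show "let vs = xs @ ys @ concat (map (\<lambda>j. us @ ?us') [1..<Suc 1])
        in distinct vs \<and> set vs = ?V"
      using dist V us xs ys by (auto simp: Let_def)
    show "set xs \<union> set ys \<noteq> {}"
      using fixed xs ys by (auto simp: W1_def W2_def)
    show "\<forall>j\<in>{1..1::nat}. adj_block \<Gamma> (us @ ?us') (us @ ?us') =
        four_block_mat (adj_block \<Gamma> us us) (adj_block \<Gamma> us ?us')
          (- adj_block \<Gamma> us ?us') (- adj_block \<Gamma> us us)"
      by (simp add: adj_block_append B Y)
    show "\<forall>j\<in>{1..1::nat}.
       adj_block \<Gamma> us us \<in> carrier_mat (length us) (length us) \<and>
       adj_block \<Gamma> us ?us' \<in> carrier_mat (length us) (length us) \<and>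
       elements_mat (adj_block \<Gamma> xs us) \<subseteq> {0, 1, -1} \<and> elements_mat (adj_block \<Gamma> ys us) \<subseteq> {0, 1, -1} \<and>
       elements_mat (adj_block \<Gamma> us us) \<subseteq> {0, 1, -1} \<and>
       elements_mat (adj_block \<Gamma> us ?us') \<subseteq> {0, 1, -1} \<and>
       (adj_block \<Gamma> us us)\<^sup>T = adj_block \<Gamma> us us \<and>
       (\<forall>i<dim_row (adj_block \<Gamma> us us). adj_block \<Gamma> us us $$ (i, i) = 0) \<and>
       (adj_block \<Gamma> us ?us')\<^sup>T = - adj_block \<Gamma> us ?us'"
    proof (rule ballI, intro conjI)
      show "adj_block \<Gamma> us us \<in> carrier_mat (length us) (length us)"
        by (rule adj_block_carrier)
      show "adj_block \<Gamma> us ?us' \<in> carrier_mat (length us) (length us)"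
        using adj_block_carrier[of \<Gamma> us ?us'] by (simp only: length_map)
      show "(adj_block \<Gamma> us us)\<^sup>T = adj_block \<Gamma> us us" by (rule adj_block_transpose)
      \<comment> \<open>Symmetry of the adjacency matrix turns the transpose into the opposite
        off-diagonal block.\<close>
      show "(adj_block \<Gamma> us ?us')\<^sup>T = - adj_block \<Gamma> us ?us'"
        by (rule trans[OF adj_block_transpose Y])
      show "\<forall>i<dim_row (adj_block \<Gamma> us us). adj_block \<Gamma> us us $$ (i, i) = 0"
        by (simp add: adjacency_diag[OF \<Gamma>])
    qed (rule elements_adj_block[OF \<Gamma>])+
    show "elements_mat (adj_block \<Gamma> xs ys) \<subseteq> {0, 1, -1}" by (rule elements_adj_block[OF \<Gamma>])
  qed (use 11 22 1 2 \<open>us \<noteq> []\<close> in simp_all)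
qed

section \<open>From a block form to an involution\<close>

lemma distinct_concat_mapD:
  assumes "distinct (concat (map f xs))"
  shows "j \<in> set xs \<Longrightarrow> distinct (f j)"
    and "j \<in> set xs \<Longrightarrow> k \<in> set xs \<Longrightarrow> j \<noteq> k \<Longrightarrow> set (f j) \<inter> set (f k) = {}"
  using assms by (induction xs) auto

text \<open>Lets the exchange of two blocks be written on indices: it is transported along an
  injective parametrization and extended by the identity.\<close>

lemma involution_of_index_involution:
  assumes "inj_on g I" "\<And>p. p \<in> I \<Longrightarrow> flip p \<in> I \<and> flip (flip p) = p"
  obtains \<phi> where "\<And>p. p \<in> I \<Longrightarrow> \<phi> (g p) = g (flip p)" "\<And>x. x \<notin> g ` I \<Longrightarrow> \<phi> x = x"
    "\<And>x. \<phi> (\<phi> x) = x"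
proof -
  define \<phi> where "\<phi> x = (if x \<in> g ` I then g (flip (inv_into I g x)) else x)" for x
  have 1: "\<phi> (g p) = g (flip p)" if "p \<in> I" for p
    using that assms(1) by (simp add: \<phi>_def)
  have 2: "\<phi> x = x" if "x \<notin> g ` I" for x using that by (simp add: \<phi>_def)
  have "\<phi> (\<phi> x) = x" for x
  proof (cases "x \<in> g ` I")
    case True
    then obtain p where "p \<in> I" "x = g p" by blast
    then show ?thesis using 1 assms(2)[of p] by simp
  qed (simp add: 2)
  with 1 2 show ?thesis using that by blast
qed

text \<open>The involution exchanges equal positions of \<open>U1 j\<close> and \<open>U2 j\<close>.
  The signs are read off from the rows of the fixed blocks: with 1 on \<open>\<Omega>1\<close> and
  -1 on \<open>\<Omega>2\<close>, the blocks up to \<open>m\<close> require -1 and the later ones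
  1.\<close>

lemma involution_of_block_form:
  assumes \<Gamma>: "signed_graph \<Gamma>" and "block_form \<Gamma>"
  obtains \<phi> v\<^sub>0 \<theta> where "\<phi> permutes verts (fst \<Gamma>)" "\<And>v. \<phi> (\<phi> v) = v" "\<phi> \<noteq> id"
    "v\<^sub>0 \<in> verts (fst \<Gamma>)" "\<phi> v\<^sub>0 = v\<^sub>0" "switching_map \<phi> \<theta> \<Gamma> (neg_signed \<Gamma>)"
proof -
  obtain s m \<Omega>1 \<Omega>2 U1 U2 D1 D2 B Y
    where low: "\<forall>j\<in>{1..m}.
           adj_block \<Gamma> \<Omega>1 (U1 j) = D1 j \<and> adj_block \<Gamma> \<Omega>1 (U2 j) = D1 j \<and>
           adj_block \<Gamma> \<Omega>2 (U1 j) = D2 j \<and> adj_block \<Gamma> \<Omega>2 (U2 j) = - D2 j"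
    and diag: "\<forall>j\<in>{1..s}. adj_block \<Gamma> (U1 j @ U2 j) (U1 j @ U2 j) =
             four_block_mat (B j) (Y j) (- Y j) (- B j)"
    and s: "1 \<le> (s::nat)" "m \<le> s"
    and V: "let vs = \<Omega>1 @ \<Omega>2 @ concat (map (\<lambda>j. U1 j @ U2 j) [1..<Suc s])
         in distinct vs \<and> set vs = verts (fst \<Gamma>)"
    and \<Omega>: "set \<Omega>1 \<union> set \<Omega>2 \<noteq> {}"
    and U: "\<forall>j\<in>{1..s}. U1 j \<noteq> [] \<and> length (U1 j) = length (U2 j)"
    and b11: "adj_block \<Gamma> \<Omega>1 \<Omega>1 = 0\<^sub>m (length \<Omega>1) (length \<Omega>1)"
    and b22: "adj_block \<Gamma> \<Omega>2 \<Omega>2 = 0\<^sub>m (length \<Omega>2) (length \<Omega>2)"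
    and high: "\<forall>j\<in>{m+1..s}.
           adj_block \<Gamma> \<Omega>1 (U1 j) = D1 j \<and> adj_block \<Gamma> \<Omega>1 (U2 j) = - D1 j \<and>
           adj_block \<Gamma> \<Omega>2 (U1 j) = D2 j \<and> adj_block \<Gamma> \<Omega>2 (U2 j) = D2 j"
    and off: "\<forall>j\<in>{1..s}. \<forall>k\<in>{1..s}. j \<noteq> k \<longrightarrow>
           adj_block \<Gamma> (U1 j @ U2 j) (U1 k @ U2 k) =
             0\<^sub>m (length (U1 j @ U2 j)) (length (U1 k @ U2 k))"
    and carr: "\<forall>j\<in>{1..s}.
           B j \<in> carrier_mat (length (U1 j)) (length (U1 j)) \<and>
           Y j \<in> carrier_mat (length (U1 j)) (length (U1 j)) \<and>
           elements_mat (D1 j) \<subseteq> {0, 1, -1} \<and> elements_mat (D2 j) \<subseteq> {0, 1, -1} \<and>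
           elements_mat (B j) \<subseteq> {0, 1, -1} \<and> elements_mat (Y j) \<subseteq> {0, 1, -1} \<and>
           (B j)\<^sup>T = B j \<and> (\<forall>i<dim_row (B j). B j $$ (i, i) = 0) \<and>
           (Y j)\<^sup>T = - Y j"
    using assms(2) unfolding block_form_def by (elim exE conjE) (rule that; assumption)
  define a where "a = adjacency \<Gamma>"
  have a_sym: "a u v = a v u" for u v unfolding a_def by (rule adjacency_commute)
  \<comment> \<open>The triple \<open>(j, i, b)\<close> addresses position \<open>i\<close> of
    \<open>U2 j\<close> if \<open>b\<close> holds and of \<open>U1 j\<close> otherwise.\<close>
  define I where "I = {(j, i, b :: bool). j \<in> {1..s} \<and> i < length (U1 j)}"
  define g where "g = (\<lambda>(j, i, b). (if b then U2 j else U1 j) ! i)"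
  define flip :: "nat \<times> nat \<times> bool \<Rightarrow> nat \<times> nat \<times> bool"
    where "flip = (\<lambda>(j, i, b). (j, i, \<not> b))"
  let ?ls = "\<lambda>j. U1 j @ U2 j"
  have dist: "distinct (\<Omega>1 @ \<Omega>2 @ concat (map ?ls [1..<Suc s]))"
    and Vset: "verts (fst \<Gamma>) = set \<Omega>1 \<union> set \<Omega>2 \<union> (\<Union>j\<in>{1..s}. set (?ls j))"
    using V by (auto simp: Let_def atLeastLessThanSuc_atLeastAtMost simp del: upt_Suc)
  have distU: "distinct (?ls j)" if "j \<in> {1..s}" for j
    using dist that by (intro distinct_concat_mapD(1)[of ?ls "[1..<Suc s]"]) auto
  have disjU: "set (?ls j) \<inter> set (?ls k) = {}" if "j \<in> {1..s}" "k \<in> {1..s}" "j \<noteq> k" for j k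
    using dist that by (intro distinct_concat_mapD(2)[of ?ls "[1..<Suc s]"]) auto
  have disj\<Omega>: "set \<Omega>1 \<inter> set \<Omega>2 = {}" "(set \<Omega>1 \<union> set \<Omega>2) \<inter> (\<Union>j\<in>{1..s}. set (?ls j)) = {}"
    using dist by (auto simp: atLeastLessThanSuc_atLeastAtMost simp del: upt_Suc)
  have g_in: "g (j, i, b) \<in> set (?ls j)" if "(j, i, b) \<in> I" for j i b
    using that U by (auto simp: g_def I_def)
  have gI: "g ` I = (\<Union>j\<in>{1..s}. set (?ls j))"
  proof
    show "g ` I \<subseteq> (\<Union>j\<in>{1..s}. set (?ls j))"
      using g_in by (force simp: I_def)
    show "(\<Union>j\<in>{1..s}. set (?ls j)) \<subseteq> g ` I"
    proof
      fix x assume "x \<in> (\<Union>j\<in>{1..s}. set (?ls j))"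
      then obtain j where j: "j \<in> {1..s}" and "x \<in> set (U1 j) \<or> x \<in> set (U2 j)" by auto
      then show "x \<in> g ` I"
      proof (elim disjE)
        assume "x \<in> set (U1 j)"
        then obtain i where "i < length (U1 j)" "x = U1 j ! i" unfolding in_set_conv_nth by blast
        then show ?thesis
          using j by (intro image_eqI[of _ _ "(j, i, False)"]) (simp_all add: g_def I_def)
      next
        assume "x \<in> set (U2 j)"
        then obtain i where "i < length (U2 j)" "x = U2 j ! i" unfolding in_set_conv_nth by blast
        then show ?thesis
          using j U by (intro image_eqI[of _ _ "(j, i, True)"]) (simp_all add: g_def I_def)
      qed
    qed
  qed
  have inj: "inj_on g I"
  proof (rule inj_onI)
    fix p q assume pq: "p \<in> I" "q \<in> I" "g p = g q"
    obtain j i b k l c where p: "p = (j, i, b)" "q = (k, l, c)" by (cases p, cases q)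
    have jk: "j \<in> {1..s}" "k \<in> {1..s}" using pq p by (auto simp: I_def)
    have "j = k" using g_in[of j i b] g_in[of k l c] pq disjU[OF jk] unfolding p by auto
    have n: "length (U2 j) = length (U1 j)" using U jk by simp
    have il: "i < length (U1 j)" "l < length (U1 j)"
      using pq \<open>j = k\<close> by (simp_all add: p I_def)
    have ne: "U1 j ! i' \<noteq> U2 j ! l'" if "i' < length (U1 j)" "l' < length (U1 j)" for i' l'
    proof -
      have "U1 j ! i' \<in> set (U1 j)" "U2 j ! l' \<in> set (U2 j)" using that n by simp_all
      then show ?thesis using distU[OF jk(1)] unfolding distinct_append disjoint_iff by metis
    qed
    have "distinct (U1 j)" "distinct (U2 j)" using distU[OF jk(1)] by simp_all
    then have "b = c \<and> i = l"
      using pq(3) il n ne[OF il] ne[OF il(2,1)] \<open>j = k\<close>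
      by (cases b; cases c) (simp_all add: p g_def nth_eq_iff_index_eq)
    with \<open>j = k\<close>    show "p = q" by (simp add: p)
  qed
  obtain \<phi> where \<phi>: "\<And>p. p \<in> I \<Longrightarrow> \<phi> (g p) = g (flip p)" "\<And>x. x \<notin> g ` I \<Longrightarrow> \<phi> x = x"
    "\<And>x. \<phi> (\<phi> x) = x"
    using involution_of_index_involution[OF inj, of flip] by (auto simp: flip_def I_def)
  have flip: "flip (j, i, b) = (j, i, \<not> b)" for j i b by (simp add: flip_def)
  have flipI: "(j, i, \<not> b) \<in> I \<longleftrightarrow> (j, i, b) \<in> I" for j i b by (simp add: I_def)
  have \<phi>\<Omega>: "\<phi> x = x" if "x \<in> set \<Omega>1 \<union> set \<Omega>2" for x
    using that disj\<Omega>(2) \<phi>(2)[of x] unfolding gI by blast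
  \<comment> \<open>The value of \<open>\<theta>\<close> on both blocks of index \<open>j\<close>:
    minus the factor by which the rows of \<open>\<Omega>1\<close> change from \<open>U1 j\<close>
    to \<open>U2 j\<close>.\<close>
  define t where "t j = (if j \<le> m then -1 else 1 :: int)" for j
  define \<theta> where "\<theta> x = (if x \<in> set \<Omega>1 then 1 else if x \<in> set \<Omega>2 then -1
    else if x \<in> (\<Union>j\<in>{1..m}. set (?ls j)) then -1 else 1 :: int)" for x
  have \<theta>1: "\<theta> x = 1" if "x \<in> set \<Omega>1" for x using that by (simp add: \<theta>_def)
  have \<theta>2: "\<theta> x = -1" if "x \<in> set \<Omega>2" for x using that disj\<Omega>(1) by (auto simp: \<theta>_def)
  have \<theta>g: "\<theta> (g (j, i, b)) = t j" if p: "(j, i, b) \<in> I" for j i b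
  proof -
    have j: "j \<in> {1..s}" using p by (simp add: I_def)
    have "g (j, i, b) \<notin> set \<Omega>1" "g (j, i, b) \<notin> set \<Omega>2"
      using g_in[OF p] j disj\<Omega>(2) by blast+
    moreover have "g (j, i, b) \<in> (\<Union>k\<in>{1..m}. set (?ls k)) \<longleftrightarrow> j \<le> m"
    proof
      assume "g (j, i, b) \<in> (\<Union>k\<in>{1..m}. set (?ls k))"
      then obtain k where k: "k \<in> {1..m}" "g (j, i, b) \<in> set (?ls k)" by blast
      then have "k \<in> {1..s}" using s by simp
      with k g_in[OF p] disjU[OF j] have "j = k" by blast
      then show "j \<le> m" using k by simp
    next
      assume "j \<le> m"
      then show "g (j, i, b) \<in> (\<Union>k\<in>{1..m}. set (?ls k))" using g_in[OF p] j by auto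
    qed
    ultimately show ?thesis by (simp add: \<theta>_def t_def)
  qed
  have e11: "a x y = 0" if "x \<in> set \<Omega>1" "y \<in> set \<Omega>1" for x y
  proof -
    obtain p q where "p < length \<Omega>1" "q < length \<Omega>1" "x = \<Omega>1 ! p" "y = \<Omega>1 ! q"
      using \<open>x \<in> set \<Omega>1\<close> \<open>y \<in> set \<Omega>1\<close> by (metis in_set_conv_nth)
    then show ?thesis
      using arg_cong[OF b11, where f = "\<lambda>M. M $$ (p, q)"] by (simp add: a_def)
  qed
  have e22: "a x y = 0" if "x \<in> set \<Omega>2" "y \<in> set \<Omega>2" for x y
  proof -
    obtain p q where "p < length \<Omega>2" "q < length \<Omega>2" "x = \<Omega>2 ! p" "y = \<Omega>2 ! q"
      using \<open>x \<in> set \<Omega>2\<close> \<open>y \<in> set \<Omega>2\<close> by (metis in_set_conv_nth)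
    then show ?thesis
      using arg_cong[OF b22, where f = "\<lambda>M. M $$ (p, q)"] by (simp add: a_def)
  qed
  have blocks: "adj_block \<Gamma> \<Omega>1 (U2 j) = (if j \<le> m then adj_block \<Gamma> \<Omega>1 (U1 j) else - adj_block \<Gamma> \<Omega>1 (U1 j))"
    "adj_block \<Gamma> \<Omega>2 (U2 j) = (if j \<le> m then - adj_block \<Gamma> \<Omega>2 (U1 j) else adj_block \<Gamma> \<Omega>2 (U1 j))"
    if "j \<in> {1..s}" for j
    using that bspec[OF low, of j] bspec[OF high, of j] by auto
  have e1: "a x (U2 j ! i) = - t j * a x (U1 j ! i)"
    if x: "x \<in> set \<Omega>1" and j: "j \<in> {1..s}" and i: "i < length (U1 j)" for x j i
  proof -
    obtain p where p: "p < length \<Omega>1" "x = \<Omega>1 ! p" using x by (metis in_set_conv_nth)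
    have "i < length (U2 j)" using U j i by simp
    then show ?thesis using p i arg_cong[OF blocks(1)[OF j], where f = "\<lambda>M. M $$ (p, i)"]
      by (cases "j \<le> m") (simp_all add: a_def t_def)
  qed
  have e2: "a x (U2 j ! i) = t j * a x (U1 j ! i)"
    if x: "x \<in> set \<Omega>2" and j: "j \<in> {1..s}" and i: "i < length (U1 j)" for x j i
  proof -
    obtain p where p: "p < length \<Omega>2" "x = \<Omega>2 ! p" using x by (metis in_set_conv_nth)
    have "i < length (U2 j)" using U j i by simp
    then show ?thesis using p i arg_cong[OF blocks(2)[OF j], where f = "\<lambda>M. M $$ (p, i)"]
      by (cases "j \<le> m") (simp_all add: a_def t_def)
  qed
  have tt: "t j * t j = 1" for j by (simp add: t_def)
  \<comment> \<open>Since \<open>t j\<close> is its own inverse, the same factor leads back from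
    \<open>U2 j\<close> to \<open>U1 j\<close>, so the rule holds for either value of
    \<open>b\<close>.\<close>
  have E1: "a x (g (j, i, \<not> b)) = - t j * a x (g (j, i, b))"
    if "x \<in> set \<Omega>1" "(j, i, b) \<in> I" for x j i b
  proof -
    have ji: "j \<in> {1..s}" "i < length (U1 j)" using that by (simp_all add: I_def)
    show ?thesis using e1[OF that(1) ji] by (cases b) (simp_all add: g_def t_def)
  qed
  have E2: "a x (g (j, i, \<not> b)) = t j * a x (g (j, i, b))"
    if "x \<in> set \<Omega>2" "(j, i, b) \<in> I" for x j i b
  proof -
    have ji: "j \<in> {1..s}" "i < length (U1 j)" using that by (simp_all add: I_def)
    show ?thesis using e2[OF that(1) ji] by (cases b) (simp_all add: g_def t_def)
  qed
  have Eoff: "a (g (j, i, b)) (g (k, l, c)) = 0"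
    if "(j, i, b) \<in> I" "(k, l, c) \<in> I" "j \<noteq> k" for j i b k l c
  proof -
    have jk: "j \<in> {1..s}" "k \<in> {1..s}" using that by (simp_all add: I_def)
    obtain p q where p: "p < length (?ls j)" "g (j, i, b) = ?ls j ! p"
      and q: "q < length (?ls k)" "g (k, l, c) = ?ls k ! q"
      using g_in[OF \<open>(j, i, b) \<in> I\<close>] g_in[OF \<open>(k, l, c) \<in> I\<close>]
      unfolding in_set_conv_nth by metis
    have "adj_block \<Gamma> (?ls j) (?ls k) = 0\<^sub>m (length (?ls j)) (length (?ls k))"
      using off jk that(3) by blast
    from arg_cong[OF this, where f = "\<lambda>M. M $$ (p, q)"] show ?thesis
      using p q by (simp add: a_def)
  qed
  \<comment> \<open>Changing halves in both arguments moves to the diagonally opposite quarter of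
    the block matrix, which has the opposite sign for \<open>B j\<close> as well as for
    \<open>Y j\<close>.\<close>
  have Ediag: "a (g (j, i, \<not> b)) (g (j, l, \<not> c)) = - a (g (j, i, b)) (g (j, l, c))"
    if "(j, i, b) \<in> I" "(j, l, c) \<in> I" for j i b l c
  proof -
    let ?n = "length (U1 j)"
    have j: "j \<in> {1..s}" and il: "i < ?n" "l < ?n" using that by (simp_all add: I_def)
    have n: "length (U2 j) = ?n" using U j by simp
    have BY: "dim_row (B j) = ?n" "dim_col (B j) = ?n" "dim_row (Y j) = ?n" "dim_col (Y j) = ?n"
      using carr j by auto
    have M: "adjacency \<Gamma> (?ls j ! p) (?ls j ! q) = four_block_mat (B j) (Y j) (- Y j) (- B j) $$ (p, q)"
      if "p < ?n + ?n" "q < ?n + ?n" for p q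
      using that n adj_block_nth[of p "?ls j" q "?ls j" \<Gamma>] bspec[OF diag j] by simp
    have "a (U1 j ! i) (U1 j ! l) = B j $$ (i, l)"
      using M[of i l] il BY by (simp add: a_def nth_append)
    moreover have "a (U2 j ! i) (U2 j ! l) = - B j $$ (i, l)"
      using M[of "?n + i" "?n + l"] il BY n by (simp add: a_def nth_append)
    moreover have "a (U1 j ! i) (U2 j ! l) = Y j $$ (i, l)"
      using M[of i "?n + l"] il BY n by (simp add: a_def nth_append)
    moreover have "a (U2 j ! i) (U1 j ! l) = - Y j $$ (i, l)"
      using M[of "?n + i" l] il BY n by (simp add: a_def nth_append)
    ultimately show ?thesis by (cases b; cases c) (simp_all add: g_def)
  qed
  have \<Omega>U: "a u (\<phi> v) = - (\<theta> u * \<theta> v * a u v)" if u: "u \<in> set \<Omega>1 \<union> set \<Omega>2" and v: "v \<in> g ` I" for u v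
  proof -
    obtain j i b where p: "(j, i, b) \<in> I" "v = g (j, i, b)" using v by auto
    show ?thesis
      using u \<theta>1 \<theta>2 E1[OF _ p(1)] E2[OF _ p(1)] \<phi>(1)[OF p(1)] \<theta>g[OF p(1)] by (auto simp: p(2) flip)
  qed
  \<comment> \<open>Within \<open>\<Omega>1\<close> and within \<open>\<Omega>2\<close> the entries
    vanish; between them the signs multiply to -1.\<close>
  have \<Omega>\<Omega>: "a u v = - (\<theta> u * \<theta> v * a u v)" if "u \<in> set \<Omega>1 \<union> set \<Omega>2" "v \<in> set \<Omega>1 \<union> set \<Omega>2" for u v
    using that \<theta>1 \<theta>2 e11 e22 by auto
  have UU: "a (\<phi> u) (\<phi> v) = - (\<theta> u * \<theta> v * a u v)" if u: "u \<in> g ` I" and v: "v \<in> g ` I" for u v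
  proof -
    obtain j i b where p: "(j, i, b) \<in> I" "u = g (j, i, b)" using u by auto
    obtain k l c where q: "(k, l, c) \<in> I" "v = g (k, l, c)" using v by auto
    show ?thesis
    \<comment> \<open>For equal indices the two signs agree and cancel; for different indices both
      entries are 0.\<close>
    proof (cases "j = k")
      case True
      then show ?thesis
        using Ediag[of j i b l c] p q \<phi>(1)[OF p(1)] \<phi>(1)[OF q(1)] \<theta>g[OF p(1)] \<theta>g[OF q(1)] tt[of k]
        by (simp add: flip)
    next
      case False
      then show ?thesis
        using Eoff[OF p(1) q(1)] Eoff[of j i "\<not> b" k l "\<not> c"] p q \<phi>(1)[OF p(1)] \<phi>(1)[OF q(1)]
        by (simp add: flip flipI)
    qed
  qed
  have V': "verts (fst \<Gamma>) = (set \<Omega>1 \<union> set \<Omega>2) \<union> g ` I" unfolding Vset gI ..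
  have main: "a (\<phi> u) (\<phi> v) = - (\<theta> u * \<theta> v * a u v)"
    if "u \<in> verts (fst \<Gamma>)" "v \<in> verts (fst \<Gamma>)" for u v
  proof -
    have "u \<in> set \<Omega>1 \<union> set \<Omega>2 \<or> u \<in> g ` I" "v \<in> set \<Omega>1 \<union> set \<Omega>2 \<or> v \<in> g ` I"
      using that unfolding V' by blast+
    then show ?thesis
    proof (elim disjE)
      assume "u \<in> set \<Omega>1 \<union> set \<Omega>2" "v \<in> set \<Omega>1 \<union> set \<Omega>2"
      then show ?thesis using \<Omega>\<Omega> \<phi>\<Omega> by presburger
    next
      assume "u \<in> set \<Omega>1 \<union> set \<Omega>2" "v \<in> g ` I"
      then show ?thesis using \<Omega>U \<phi>\<Omega> by presburger
    next
      assume uv: "u \<in> g ` I" "v \<in> set \<Omega>1 \<union> set \<Omega>2"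
      show ?thesis using \<Omega>U[OF uv(2,1)] \<phi>\<Omega>[OF uv(2)]
        by (simp add: a_sym[of "\<phi> u" v] a_sym[of u v] mult.commute[of "\<theta> u"])
    next
      assume "u \<in> g ` I" "v \<in> g ` I"
      then show ?thesis by (rule UU)
    qed
  qed
  have perm: "\<phi> permutes verts (fst \<Gamma>)"
    using involution_permutes[OF \<phi>(3)] \<phi>(2) unfolding V' by blast
  have "switching_map \<phi> \<theta> \<Gamma> (neg_signed \<Gamma>)"
    unfolding switching_map_def adjacency_neg_signed
    using permutes_imp_bij[OF perm] main by (auto simp: a_def \<theta>_def)
  moreover obtain v\<^sub>0 where "v\<^sub>0 \<in> set \<Omega>1 \<union> set \<Omega>2" using \<Omega> ex_in_conv by metis
  moreover have "\<phi> \<noteq> id"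
  proof
    assume "\<phi> = id"
    \<comment> \<open>A first position exists since \<open>U1 1\<close> is nonempty, and injectivity
      of \<open>g\<close> separates it from its partner.\<close>
    have "(1, 0, False) \<in> I" using s bspec[OF U, of 1] by (auto simp: I_def)
    then have "g (1, 0, False) = g (1, 0, True)" "(1, 0, True) \<in> I"
      using \<phi>(1)[of "(1, 0, False)"] by (simp_all add: flip flipI[of _ _ False, simplified] \<open>\<phi> = id\<close>)
    with \<open>(1, 0, False) \<in> I\<close> show False using inj_onD[OF inj] by blast
  qed
  ultimately show ?thesis using that[OF perm \<phi>(3)] \<phi>\<Omega> V' by blast
qed

section \<open>The characterization\<close>

text \<open>Signs square to 1, so the same \<open>\<tau>\<close> leads to the switched graph and
  back.\<close>

lemma switching_map_switching:
  assumes "\<And>v. \<tau> v \<in> {1, -1 :: int}"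
  shows "switching_map id \<tau> \<Gamma> (switching {v. \<tau> v = -1} \<Gamma>)"
    and "switching_map id \<tau> (switching {v. \<tau> v = -1} \<Gamma>) \<Gamma>"
proof -
  have adj: "adjacency (switching {v. \<tau> v = -1} \<Gamma>) u v = \<tau> u * \<tau> v * adjacency \<Gamma> u v"
    if "u \<in> verts (fst \<Gamma>)" "v \<in> verts (fst \<Gamma>)" for u v
    using assms[of u] assms[of v] by (auto simp: adjacency_switching[OF that])
  then show "switching_map id \<tau> \<Gamma> (switching {v. \<tau> v = -1} \<Gamma>)"
    using assms by (simp add: switching_map_def)
  have "adjacency \<Gamma> u v = \<tau> u * \<tau> v * adjacency (switching {v. \<tau> v = -1} \<Gamma>) u v"
    if "u \<in> verts (fst \<Gamma>)" "v \<in> verts (fst \<Gamma>)" for u v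
    using assms[of u] assms[of v] adj[OF that] by auto
  then show "switching_map id \<tau> (switching {v. \<tau> v = -1} \<Gamma>) \<Gamma>"
    using assms by (simp add: switching_map_def)
qed

text \<open>Applying the switching identity twice shows that \<open>\<theta> v * \<theta> (\<phi> v)\<close> agrees at the two ends of
  every edge, hence is constant by connectivity; at a fixed vertex it is a square.\<close>

lemma switching_function_invariant:
  assumes G: "signed_graph (G, \<sigma>)" "connected_graph G"
    and sm: "switching_map \<phi> \<theta> (G, \<sigma>) (neg_signed (G, \<sigma>))"
    and invol: "\<And>v. \<phi> (\<phi> v) = v"
    and fixed: "v\<^sub>0 \<in> verts G" "\<phi> v\<^sub>0 = v\<^sub>0"
    and v: "v \<in> verts G"
  shows "\<theta> (\<phi> v) = \<theta> v"
proof -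
  have pm: "\<theta> v \<in> {1, -1}" for v using sm by (simp add: switching_map_def)
  have \<phi>V: "\<phi> v \<in> verts G" if "v \<in> verts G" for v
    using sm that by (auto simp: switching_map_def bij_betw_def)
  have adj: "adjacency (G, \<sigma>) (\<phi> u) (\<phi> v) = - (\<theta> u * \<theta> v * adjacency (G, \<sigma>) u v)"
    if "u \<in> verts G" "v \<in> verts G" for u v
  proof -
    have "- adjacency (G, \<sigma>) (\<phi> u) (\<phi> v) = \<theta> u * \<theta> v * adjacency (G, \<sigma>) u v"
      using sm that unfolding switching_map_def adjacency_neg_signed by simp
    then show ?thesis by linarith
  qed
  have step: "\<theta> x * \<theta> (\<phi> x) = \<theta> y * \<theta> (\<phi> y)" if e: "{x, y} \<in> edges G" for x y
  proof -
    have xy: "x \<in> verts G" "y \<in> verts G" using signed_graphD(4)[OF G(1) e] by simp_all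
    have "adjacency (G, \<sigma>) x y = \<theta> (\<phi> x) * \<theta> (\<phi> y) * (\<theta> x * \<theta> y * adjacency (G, \<sigma>) x y)"
      using adj[OF \<phi>V[OF xy(1)] \<phi>V[OF xy(2)]] adj[OF xy] by (simp add: invol)
    moreover have "adjacency (G, \<sigma>) x y \<noteq> 0" using adjacency_eq_0_iff[OF G(1), of x y] e by simp
    ultimately have "\<theta> (\<phi> x) * \<theta> (\<phi> y) * (\<theta> x * \<theta> y) = 1" by simp
    then show ?thesis using pm[of x] pm[of y] pm[of "\<phi> x"] pm[of "\<phi> y"] by auto
  qed
  have "(v\<^sub>0, v) \<in> {(x, y). {x, y} \<in> edges G}\<^sup>*"
    using G(2) fixed v unfolding connected_graph_def by blast
  then have "\<theta> v * \<theta> (\<phi> v) = \<theta> v\<^sub>0 * \<theta> (\<phi> v\<^sub>0)"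
    by induction (auto dest: step)
  also have "\<dots> = 1" using pm_one_square[OF pm] by (simp add: fixed)
  finally show ?thesis using pm[of v] pm[of "\<phi> v"] by auto
qed

text \<open>The identity keeps the nonzero sign of an odd cycle, which a weak automorphism must
  negate.\<close>

lemma weak_automorphism_not_id:
  assumes "signed_graph (G, \<sigma>)" "connected_graph G" "\<not> bipartite G"
    and "weak_automorphism (G, \<sigma>) \<phi>"
  shows "\<phi> \<noteq> id"
proof
  assume "\<phi> = id"
  obtain c where c: "graph_cycle G c" "odd (length c)"
    using not_bipartite_odd_cycle[OF signed_graphD(1)[OF assms(1)] assms(2,3)] by metis
  then have "cycle_sign \<sigma> c = - cycle_sign \<sigma> c" using assms(4) \<open>\<phi> = id\<close> by auto
  moreover have "cycle_sign \<sigma> c \<in> {1, -1}"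
    using walk_sign_pm_one[OF assms(1) graph_cycle_walk[OF c(1)]]
    by (simp add: graph_cycle_sign[OF c(1)])
  ultimately show False by auto
qed

theorem theorem4p5:
  fixes G :: "'a graph" and \<sigma> :: "'a set \<Rightarrow> int"
  assumes "signed_graph (G, \<sigma>)"
    and "connected_graph G"
    and "\<not> bipartite G"
  shows "(G, \<sigma>) \<in> FS1 G \<longleftrightarrow>
    (\<exists>\<Gamma>' :: 'a signed_graph. signed_graph \<Gamma>' \<and> (G, \<sigma>) \<simeq>\<^sub>s \<Gamma>' \<and> block_form \<Gamma>')"
proof
  let ?\<Gamma> = "(G, \<sigma>)"
  have fin: "finite (verts G)" using signed_graphD(2)[OF assms(1)] .
  assume "?\<Gamma> \<in> FS1 G"
  then obtain \<phi> v\<^sub>0 where wa: "weak_automorphism ?\<Gamma> \<phi>" and ord: "perm_order \<phi> = 2"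
    and fixed: "v\<^sub>0 \<in> verts G" "\<phi> v\<^sub>0 = v\<^sub>0"
    by (auto simp: FS1_def principal_weak_automorphism_def)
  obtain \<theta> where perm: "\<phi> permutes verts G" and sm: "switching_map \<phi> \<theta> ?\<Gamma> (neg_signed ?\<Gamma>)"
    using wa weak_automorphism_iff_switching_map[OF assms(1,2)] by blast
  have "\<phi> \<circ> \<phi> = id" and not_id: "\<phi> \<noteq> id"
    using ord perm_order_eq_2_iff[OF perm fin] by simp_all
  then have invol: "\<phi> (\<phi> v) = v" for v by (simp add: fun_eq_iff)
  have pm: "\<theta> v \<in> {1, -1}" for v using sm by (simp add: switching_map_def)
  have \<theta>: "\<theta> (\<phi> v) = \<theta> v" if "v \<in> verts G" for v
    by (rule switching_function_invariant[OF assms(1,2) sm invol fixed that])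
  obtain h :: "'a \<Rightarrow> nat" where h: "inj_on h (verts G)"
    using finite_imp_inj_to_nat_seg[OF fin] by blast
  \<comment> \<open>In each two-element orbit \<open>\<tau>\<close> copies \<open>\<theta>\<close>
    at the vertex with the larger label; the other vertex and all fixed vertices get 1.\<close>
  define \<tau> where "\<tau> v = (if v \<in> verts G \<and> h (\<phi> v) < h v then \<theta> v else 1)" for v
  have \<tau>: "\<tau> v \<in> {1, -1}" for v using pm[of v] by (simp add: \<tau>_def)
  define \<Gamma>' where "\<Gamma>' = switching {v. \<tau> v = -1} ?\<Gamma>"
  have \<Gamma>': "signed_graph \<Gamma>'" and V': "verts (fst \<Gamma>') = verts G"
    unfolding \<Gamma>'_def by (rule signed_graph_switching[OF assms(1)]) simp
  have sw: "switching_map id \<tau> ?\<Gamma> \<Gamma>'" "switching_map id \<tau> \<Gamma>' ?\<Gamma>"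
    unfolding \<Gamma>'_def by (rule switching_map_switching[OF \<tau>])+
  \<comment> \<open>Switching back, applying \<open>\<phi>\<close> and switching again:
    \<open>\<phi>\<close> acts on \<open>\<Gamma>'\<close> with \<open>\<theta> v\<close> multiplied
    by \<open>\<tau> v\<close> and \<open>\<tau> (\<phi> v)\<close>.\<close>
  have sm': "switching_map (id \<circ> (\<phi> \<circ> id)) (\<lambda>v. (\<tau> v * \<theta> (id v)) * \<tau> ((\<phi> \<circ> id) v)) \<Gamma>' (neg_signed \<Gamma>')"
    by (rule switching_map_comp[OF switching_map_comp[OF sw(2) sm] switching_map_neg_signed[OF sw(1)]])
  \<comment> \<open>Exactly one of \<open>v\<close> and \<open>\<phi> v\<close> has the larger
    label, and \<open>\<theta>\<close> agrees at both, so the product is the square of a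
    sign.\<close>
  have "\<tau> v * \<theta> v * \<tau> (\<phi> v) = 1" if v: "v \<in> verts G" "\<phi> v \<noteq> v" for v
  proof -
    have \<phi>v: "\<phi> v \<in> verts G" using permutes_in_image[OF perm] v(1) by simp
    then have "h v \<noteq> h (\<phi> v)" using h v unfolding inj_on_def by metis
    then consider "h v < h (\<phi> v)" | "h (\<phi> v) < h v" by linarith
    then show ?thesis
      by cases (use v(1) \<phi>v invol \<theta>[OF v(1)] pm_one_square[OF pm[of v]] in \<open>simp_all add: \<tau>_def\<close>)
  qed
  then have "block_form \<Gamma>'"
    using perm invol not_id fixed
    by (intro block_form_of_involution[OF \<Gamma>' sm', of v\<^sub>0]) (simp_all add: V')
  then show "\<exists>\<Gamma>' :: 'a signed_graph. signed_graph \<Gamma>' \<and> ?\<Gamma> \<simeq>\<^sub>s \<Gamma>' \<and> block_form \<Gamma>'"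
    using \<Gamma>' sw(1) switching_isomorphic_iff[OF assms(1) \<Gamma>'] by blast
next
  let ?\<Gamma> = "(G, \<sigma>)"
  have fin: "finite (verts G)" using signed_graphD(2)[OF assms(1)] .
  assume "\<exists>\<Gamma>' :: 'a signed_graph. signed_graph \<Gamma>' \<and> ?\<Gamma> \<simeq>\<^sub>s \<Gamma>' \<and> block_form \<Gamma>'"
  then obtain \<Gamma>' :: "'a signed_graph" where \<Gamma>': "signed_graph \<Gamma>'" "?\<Gamma> \<simeq>\<^sub>s \<Gamma>'" "block_form \<Gamma>'"
    by blast
  then obtain f \<eta> where f: "switching_map f \<eta> ?\<Gamma> \<Gamma>'"
    using switching_isomorphic_iff[OF assms(1) \<Gamma>'(1)] by blast
  let ?g = "inv_into (verts G) f"
  have g: "switching_map ?g (\<eta> \<circ> ?g) \<Gamma>' ?\<Gamma>" using switching_map_inv_into[OF f] by simp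
  have bij: "bij_betw f (verts G) (verts (fst \<Gamma>'))" using f by (simp add: switching_map_def)
  obtain \<phi> w \<theta> where perm: "\<phi> permutes verts (fst \<Gamma>')" and invol: "\<And>v. \<phi> (\<phi> v) = v"
    and not_id: "\<phi> \<noteq> id" and w: "w \<in> verts (fst \<Gamma>')" "\<phi> w = w"
    and sm: "switching_map \<phi> \<theta> \<Gamma>' (neg_signed \<Gamma>')"
    by (rule involution_of_block_form[OF \<Gamma>'(1,3)], rule that)
  \<comment> \<open>The conjugate of \<open>\<phi>\<close> by \<open>f\<close>, extended by the
    identity to a permutation of the whole type.\<close>
  define \<psi> where "\<psi> v = (if v \<in> verts G then ?g (\<phi> (f v)) else v)" for v
  \<comment> \<open>The path leads from \<Gamma> to \<Gamma>', on to the negative of \<Gamma>', and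
    back to the negative of \<Gamma>.\<close>
  have "switching_map (?g \<circ> (\<phi> \<circ> f)) (\<lambda>v. (\<eta> v * \<theta> (f v)) * (\<eta> \<circ> ?g) ((\<phi> \<circ> f) v)) ?\<Gamma> (neg_signed ?\<Gamma>)"
    by (rule switching_map_comp[OF switching_map_comp[OF f sm] switching_map_neg_signed[OF g]])
  then have \<psi>: "switching_map \<psi> (\<lambda>v. (\<eta> v * \<theta> (f v)) * (\<eta> \<circ> ?g) ((\<phi> \<circ> f) v)) ?\<Gamma> (neg_signed ?\<Gamma>)"
    by (rule switching_map_cong) (simp add: \<psi>_def)
  have f_mem: "f v \<in> verts (fst \<Gamma>')" if "v \<in> verts G" for v
    using bij that by (auto simp: bij_betw_def)
  have g_mem: "?g x \<in> verts G" and fg: "f (?g x) = x" if "x \<in> verts (fst \<Gamma>')" for x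
    using bij_betwE[OF bij_betw_inv_into[OF bij]] bij_betw_inv_into_right[OF bij] that by auto
  have gf: "?g (f v) = v" if "v \<in> verts G" for v using bij_betw_inv_into_left[OF bij that] .
  have \<phi>_mem: "\<phi> x \<in> verts (fst \<Gamma>')" if "x \<in> verts (fst \<Gamma>')" for x
    using permutes_in_image[OF perm] that by simp
  have \<psi>\<psi>: "\<psi> (\<psi> v) = v" for v
    by (cases "v \<in> verts G") (simp_all add: \<psi>_def g_mem fg gf f_mem \<phi>_mem invol)
  have perm\<psi>: "\<psi> permutes verts G" by (rule involution_permutes[OF \<psi>\<psi>]) (simp add: \<psi>_def)
  have wa: "weak_automorphism ?\<Gamma> \<psi>"
    using \<psi> perm\<psi> weak_automorphism_iff_switching_map[OF assms(1,2)] by blast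
  have "\<psi> \<noteq> id" by (rule weak_automorphism_not_id[OF assms wa])
  then have ord: "perm_order \<psi> = 2" using \<psi>\<psi> by (intro perm_order_eq_2) (auto simp: fun_eq_iff)
  \<comment> \<open>No weak automorphism is the identity, so each has order at least 2 and
    \<open>\<psi>\<close> attains the minimum.\<close>
  have "perm_order \<psi> \<le> perm_order \<rho>" if "weak_automorphism ?\<Gamma> \<rho>" for \<rho>
    using perm_order_ge_2[OF _ fin weak_automorphism_not_id[OF assms that]] ord that
    by (simp add: Aut_def)
  then have "principal_weak_automorphism ?\<Gamma> \<psi>"
    using wa by (simp add: principal_weak_automorphism_def)
  \<comment> \<open>The switching map \<open>\<psi>\<close> is itself the required switching
    isomorphism to the negative.\<close>
  moreover have "sign_symmetric ?\<Gamma>"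
    unfolding sign_symmetric_def
    using \<psi> switching_isomorphic_iff[OF assms(1) signed_graph_neg_signed[OF assms(1)]] by blast
  \<comment> \<open>The fixed vertex of the block form, pulled back along \<open>f\<close>.\<close>
  moreover have "?g w \<in> {v \<in> verts G. \<psi> v = v}"
    using w by (simp add: \<psi>_def g_mem fg)
  ultimately show "?\<Gamma> \<in> FS1 G"
    using ord assms(1) unfolding FS1_def S1_def by auto
qed

end
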